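(* Let $A,E\in\mathbb{R}^{n\times m}$, $\widetilde A=A+E$, and $1\le r<\min\{n,m\}$. Let $A_r$ and $\widetilde A_r$ be the rank-$r$ thresholdings of $A$ and $\widetilde A$. Then \[\|A_r-\widetilde A_r\|\le 2\|E\|+2\sigma_{r+1}\min\Big\{\frac{2\|E\|}{\sigma_r-\sigma_{r+1}},1\Big\},\] \[\|A_r-\widetilde A_r\|_F\le\Big(2\|E_r\|_F^2+3\Big(\|E_r\|_F+\|(\Sigma_2)_r\|_F\min\Big\{\frac{2\|E\|}{\sigma_r-\sigma_{r+1}},1\Big\}\Big)^2\Big)^{1/2},\] where the minima are interpreted as $1$ when $\sigma_r=\sigma_{r+1}$.
   Context: $\sigma_1\ge\sigma_2\ge\dots$ are the singular values of $A$. For a matrix $M$, $M_r$ denotes its rank-$r$ hard thresholding: in an SVD of $M$, all but the first $r$ (largest) singular values are set to $0$. $\Sigma_2$ is the (rectangular) diagonal matrix with diagonal entries $\sigma_{r+1},\dots,\sigma_{\min\{n,m\}}$, so $\|(\Sigma_2)_r\|_F^2=\sum_{k=1}^{r}\sigma_{r+k}^2$ (with $\sigma_i=0$ for $i>\min\{n,m\}$). $\|\cdot\|$ is the spectral norm and $\|\cdot\|_F$ the Frobenius norm. *)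

theory Defs
  imports "Jordan_Normal_Form.Matrix"
begin

definition vnorm :: "real vec \<Rightarrow> real" where
  "vnorm v = sqrt (\<Sum>i<dim_vec v. (v $ i)^2)"

definition spec_norm :: "real mat \<Rightarrow> real" where
  "spec_norm M = Sup {vnorm (M *\<^sub>v x) | x. x \<in> carrier_vec (dim_col M) \<and> vnorm x = 1}"

definition frob_norm :: "real mat \<Rightarrow> real" where
  "frob_norm M = sqrt (\<Sum>i<dim_row M. \<Sum>j<dim_col M. (M $$ (i,j))^2)"

definition orth_mat :: "nat \<Rightarrow> real mat \<Rightarrow> bool" where
  "orth_mat k U \<longleftrightarrow> U \<in> carrier_mat k k \<and> transpose_mat U * U = 1\<^sub>m k \<and> U * transpose_mat U = 1\<^sub>m k"

definition is_svd :: "real mat \<Rightarrow> real mat \<Rightarrow> real mat \<Rightarrow> real mat \<Rightarrow> bool" where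
  "is_svd A U S V \<longleftrightarrow>
     orth_mat (dim_row A) U \<and> orth_mat (dim_col A) V \<and>
     S \<in> carrier_mat (dim_row A) (dim_col A) \<and>
     (\<forall>i<dim_row A. \<forall>j<dim_col A. i \<noteq> j \<longrightarrow> S $$ (i,j) = 0) \<and>
     (\<forall>i<min (dim_row A) (dim_col A). S $$ (i,i) \<ge> 0) \<and>
     (\<forall>i j. i \<le> j \<longrightarrow> j < min (dim_row A) (dim_col A) \<longrightarrow> S $$ (j,j) \<le> S $$ (i,i)) \<and>
     A = U * S * transpose_mat V"

text \<open>Singular values, 1-based: sigma A k = \<sigma>_k, and \<sigma>_k = 0 for k > min(n,m)
  (or k = 0). Taken from some SVD (they do not depend on the choice).\<close>
definition sing_val :: "real mat \<Rightarrow> nat \<Rightarrow> real" where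
  "sing_val A k =
     (let S = fst (snd (SOME (U,S,V). is_svd A U S V)) in
      if 1 \<le> k \<and> k \<le> min (dim_row A) (dim_col A) then S $$ (k - 1, k - 1) else 0)"

definition trunc_diag :: "nat \<Rightarrow> real mat \<Rightarrow> real mat" where
  "trunc_diag r S = mat (dim_row S) (dim_col S) (\<lambda>(i,j). if i = j \<and> i < r then S $$ (i,j) else 0)"

definition is_rank_thresh :: "real mat \<Rightarrow> nat \<Rightarrow> real mat \<Rightarrow> bool" where
  "is_rank_thresh M r B \<longleftrightarrow>
     (\<exists>U S V. is_svd M U S V \<and> B = U * trunc_diag r S * transpose_mat V)"

definition gap_factor :: "real mat \<Rightarrow> real mat \<Rightarrow> nat \<Rightarrow> real" where
  "gap_factor A E r =
     (if sing_val A r = sing_val A (r+1) then 1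
      else min (2 * spec_norm E / (sing_val A r - sing_val A (r+1))) 1)"

end

(*
  Write A_r, A'_r for the truncations of A and A' = A + E, P and Q for the orthogonal projections
  onto the leading r left and right singular vectors of A', X = A_r - A'_r, A_perp = A - A_r, and
  g for the gap factor. Weyl's inequality and Wedin's argument bound the sines of the angles
  between the leading singular subspaces of one matrix and the trailing ones of the other by g.

  Spectral norm. If g = 1, then X = -E - A_perp + A'_perp suffices. Otherwise put
  c = ||E|| + s_{r+1} g. One has P X = -P (E + A_perp) and X Q = -(E + A_perp) Q, both of norm at
  most c. When 2||E|| is less than the gap, every vector of range A_r makes an angle of at most
  45 degrees with range P; hence the remaining block satisfies
  ||(1-P) X (1-Q)|| = ||(1-P) A_r (1-Q)|| <= ||P A_r (1-Q)|| = ||P X (1-Q)|| <= c, and together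
  ||X|| <= sqrt 3 c.

  Frobenius norm. ||P X||_F <= ||E_r||_F + ||(Sigma_2)_r||_F g, and with Q_0 the projection onto
  the leading right singular vectors of A one has
  (1-P) X = (1-P) A Q_0 = A'_perp Q_0 - (1-P) E Q_0; the tail singular values of A' are compared
  with those of A by Ky Fan's principles.
*)

theory Submission
  imports Defs "Jordan_Normal_Form.Determinant" "HOL-Analysis.L2_Norm" "HOL-Analysis.Inner_Product"
begin

section \<open>Orthonormal families\<close>

text \<open>The sine bound g < 1 keeps the angles between the leading subspaces below 90 degrees,
  not below 45. The last spectral block needs 45, which is why \<open>acute\<close> has an argument
  of its own that uses 2||E|| < gap directly. Wedin's argument bounds left angles by right ones and
  conversely, so neither side can be treated alone. In the Frobenius estimate, g times the Frobenius
  norm of A_perp would bring in the whole tail. A projection of rank r shortens each tail singular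
  vector to squared length at most g^2, and these squares total at most r g^2. A decreasing sequence
  under such weights is controlled by r of its terms: this is how ||(Sigma_2)_r||_F arises. Using
  Q_0 instead of Q there leaves no block that requires the 45 degrees; the price is a tail of A' in
  place of one of A, and a second contribution of E.\<close>

definition orthonormal_on :: "nat set \<Rightarrow> (nat \<Rightarrow> 'a::real_inner) \<Rightarrow> bool" where
  "orthonormal_on I u \<longleftrightarrow> (\<forall>i\<in>I. \<forall>j\<in>I. inner (u i) (u j) = (if i = j then 1 else 0))"

definition proj :: "(nat \<Rightarrow> 'a::real_inner) \<Rightarrow> nat set \<Rightarrow> 'a \<Rightarrow> 'a" where
  "proj u I x = (\<Sum>i\<in>I. inner (u i) x *\<^sub>R u i)"

text \<open>The operator sum of s_i u_i v_i^T. The index set is a parameter so that the full,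
  leading and tail parts share their lemmas; exchanging \<open>u\<close> and \<open>v\<close> gives
  the transpose.\<close>

definition sing_op ::
  "(nat \<Rightarrow> real) \<Rightarrow> (nat \<Rightarrow> 'a::real_inner) \<Rightarrow> (nat \<Rightarrow> 'b::real_inner) \<Rightarrow> nat set \<Rightarrow> 'b \<Rightarrow> 'a"
  where "sing_op s u v I x = (\<Sum>i\<in>I. (s i * inner (v i) x) *\<^sub>R u i)"

lemma orthonormal_on_subset: "orthonormal_on J u \<Longrightarrow> I \<subseteq> J \<Longrightarrow> orthonormal_on I u"
  unfolding orthonormal_on_def by blast

lemma inner_lincomb:
  assumes "orthonormal_on K u" "I \<subseteq> K" "finite I" "j \<in> K"
  shows "inner (u j) (\<Sum>i\<in>I. c i *\<^sub>R u i) = (if j \<in> I then c j else 0)"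
proof -
  have "inner (u j) (\<Sum>i\<in>I. c i *\<^sub>R u i) = (\<Sum>i\<in>I. if i = j then c i else 0)"
    unfolding inner_sum_right using assms
    by (intro sum.cong) (auto simp: orthonormal_on_def)
  then show ?thesis using assms(3) by (simp add: sum.delta)
qed

lemma inner_lincomb_lincomb:
  assumes "orthonormal_on K u" "I \<subseteq> K" "finite I" "J \<subseteq> K" "finite J"
  shows "inner (\<Sum>i\<in>I. c i *\<^sub>R u i) (\<Sum>i\<in>J. d i *\<^sub>R u i) = (\<Sum>i\<in>I \<inter> J. c i * d i)"
proof -
  have "inner (\<Sum>i\<in>I. c i *\<^sub>R u i) (\<Sum>i\<in>J. d i *\<^sub>R u i)
      = (\<Sum>i\<in>I. c i * (if i \<in> J then d i else 0))"
    unfolding inner_sum_left using assms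
    by (intro sum.cong) (auto simp: inner_lincomb[OF assms(1,4,5)])
  also have "\<dots> = (\<Sum>i\<in>I. if i \<in> J then c i * d i else 0)"
    by (intro sum.cong) auto
  also have "\<dots> = (\<Sum>i\<in>I \<inter> J. c i * d i)"
    by (simp add: sum.inter_restrict assms(3))
  finally show ?thesis .
qed

lemma norm_lincomb:
  assumes "orthonormal_on I u" "finite I"
  shows "(norm (\<Sum>i\<in>I. c i *\<^sub>R u i))\<^sup>2 = (\<Sum>i\<in>I. (c i)\<^sup>2)"
  unfolding power2_norm_eq_inner using inner_lincomb_lincomb[of I u I I c c] assms
  by (simp add: power2_eq_square)

section \<open>Orthogonal projections\<close>

lemma inner_proj:
  assumes "orthonormal_on K u" "I \<subseteq> K" "finite I" "j \<in> K"
  shows "inner (u j) (proj u I x) = (if j \<in> I then inner (u j) x else 0)"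
  unfolding proj_def using inner_lincomb[OF assms] by simp

lemma norm_proj: "orthonormal_on I u \<Longrightarrow> finite I \<Longrightarrow> (norm (proj u I x))\<^sup>2 = (\<Sum>i\<in>I. (inner (u i) x)\<^sup>2)"
  unfolding proj_def by (rule norm_lincomb)

lemma proj_self_adjoint: "inner (proj u I x) y = inner x (proj u I y)"
  by (simp add: proj_def inner_sum_left inner_sum_right inner_commute mult.commute)

lemma proj_proj:
  assumes "orthonormal_on K u" "I \<subseteq> K" "J \<subseteq> K" "finite I" "finite J"
  shows "proj u I (proj u J x) = proj u (I \<inter> J) x"
proof -
  have "proj u I (proj u J x) = (\<Sum>i\<in>I. if i \<in> J then inner (u i) x *\<^sub>R u i else 0)"
    unfolding proj_def[of u I] using assms
    by (intro sum.cong) (auto simp: inner_proj[OF assms(1,3,5)])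
  then show ?thesis by (simp add: sum.inter_restrict assms(4) proj_def)
qed

lemma proj_idem: "orthonormal_on I u \<Longrightarrow> finite I \<Longrightarrow> proj u I (proj u I x) = proj u I x"
  using proj_proj[of I u I I x] by simp

lemma proj_add: "proj u I (x + y) = proj u I x + proj u I y"
  by (simp add: proj_def inner_add_right scaleR_add_left sum.distrib)

lemma proj_scaleR: "proj u I (c *\<^sub>R x) = c *\<^sub>R proj u I x"
  by (simp add: proj_def scaleR_sum_right)

lemma proj_minus: "proj u I (- x) = - proj u I x"
  using proj_scaleR[of u I "-1" x] by simp

lemma proj_diff: "proj u I (x - y) = proj u I x - proj u I y"
  using proj_add[of u I x "- y"] by (simp add: proj_minus)

lemma proj_orthogonal:
  assumes "orthonormal_on I u" "finite I"
  shows "inner (proj u I x) (y - proj u I y) = 0"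
  by (simp add: proj_self_adjoint proj_diff proj_idem[OF assms])

lemma pythagoras_proj:
  assumes "orthonormal_on I u" "finite I"
  shows "(norm x)\<^sup>2 = (norm (proj u I x))\<^sup>2 + (norm (x - proj u I x))\<^sup>2"
proof -
  have "(norm (proj u I x + (x - proj u I x)))\<^sup>2 = (norm (proj u I x))\<^sup>2 + (norm (x - proj u I x))\<^sup>2"
    using proj_orthogonal[OF assms, of x x]
    by (simp add: power2_norm_eq_inner inner_add inner_diff inner_commute)
  then show ?thesis by simp
qed

lemma norm_proj_le:
  assumes "orthonormal_on I u" "finite I"
  shows "norm (proj u I x) \<le> norm x" "norm (x - proj u I x) \<le> norm x"
proof -
  have "(norm (proj u I x))\<^sup>2 \<le> (norm x)\<^sup>2" "(norm (x - proj u I x))\<^sup>2 \<le> (norm x)\<^sup>2"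
    unfolding pythagoras_proj[OF assms, of x] by simp_all
  then show "norm (proj u I x) \<le> norm x" "norm (x - proj u I x) \<le> norm x"
    by (auto intro: power2_le_imp_le)
qed

lemma norm_proj_proj_le:
  assumes "orthonormal_on I u" "finite I" "orthonormal_on J w" "finite J"
  shows "norm (proj w J (proj u I x)) \<le> norm x"
  using norm_proj_le(1)[OF assms(3,4)] norm_proj_le(1)[OF assms(1,2)] order_trans by blast

lemma bessel:
  assumes "orthonormal_on I u" "finite I"
  shows "(\<Sum>i\<in>I. (inner (u i) x)\<^sup>2) \<le> (norm x)\<^sup>2"
  using norm_proj[OF assms, of x] norm_proj_le(1)[OF assms, of x] by (metis norm_ge_zero power_mono)

text \<open>Both sides are the squared Frobenius norm of the matrix of inner products of the two
  families.\<close>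

lemma sum_norm_proj_swap:
  assumes "orthonormal_on I u" "finite I" "orthonormal_on J w" "finite J"
  shows "(\<Sum>i\<in>I. (norm (proj w J (u i)))\<^sup>2) = (\<Sum>j\<in>J. (norm (proj u I (w j)))\<^sup>2)"
proof -
  have "(\<Sum>i\<in>I. (norm (proj w J (u i)))\<^sup>2) = (\<Sum>i\<in>I. \<Sum>j\<in>J. (inner (w j) (u i))\<^sup>2)"
    using assms by (simp add: norm_proj)
  also have "\<dots> = (\<Sum>j\<in>J. \<Sum>i\<in>I. (inner (u i) (w j))\<^sup>2)"
    by (subst sum.swap) (simp add: inner_commute)
  also have "\<dots> = (\<Sum>j\<in>J. (norm (proj u I (w j)))\<^sup>2)"
    using assms by (simp add: norm_proj)
  finally show ?thesis .
qed

text \<open>The two products of projections are adjoint to each other and so have the same norm; the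
  vector is tested against its own image.\<close>

lemma norm_proj_proj_swap:
  assumes u: "orthonormal_on I u" "finite I" and w: "orthonormal_on J w" "finite J"
    and t: "\<And>x. norm (proj w J (proj u I x)) \<le> t * norm x"
  shows "norm (proj u I (proj w J x)) \<le> t * norm x"
proof (cases "norm (proj u I (proj w J x)) = 0")
  case True
  have "0 \<le> t * norm x" using t[of x] norm_ge_zero order_trans by blast
  then show ?thesis using True by simp
next
  case False
  define y where "y = proj u I (proj w J x)"
  have y: "proj u I y = y" by (simp add: y_def proj_idem[OF u])
  have "(norm y)\<^sup>2 = inner x (proj w J (proj u I y))"
    using proj_self_adjoint[of u I "proj w J x" y] proj_self_adjoint[of w J x "proj u I y"] y
    by (simp add: power2_norm_eq_inner flip: y_def)
  also have "\<dots> \<le> norm x * norm (proj w J (proj u I y))" by (rule norm_cauchy_schwarz)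
  also have "\<dots> \<le> norm x * (t * norm y)" by (intro mult_left_mono t) simp
  finally have "norm y * norm y \<le> (t * norm x) * norm y" by (simp add: power2_eq_square mult_ac)
  then show ?thesis using False unfolding y_def[symmetric] by (simp add: mult_le_cancel_right)
qed

section \<open>Operators given by a singular value decomposition\<close>

lemma sing_op_adjoint: "inner y (sing_op s u v I x) = inner x (sing_op s v u I y)"
  by (simp add: sing_op_def inner_sum_right inner_commute mult_ac)

lemma sing_op_add: "sing_op s u v I (x + y) = sing_op s u v I x + sing_op s u v I y"
  by (simp add: sing_op_def inner_add_right distrib_left scaleR_add_left sum.distrib)

lemma sing_op_scaleR: "sing_op s u v I (c *\<^sub>R x) = c *\<^sub>R sing_op s u v I x"
  by (simp add: sing_op_def scaleR_sum_right mult_ac)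

lemma sing_op_diff: "sing_op s u v I (x - y) = sing_op s u v I x - sing_op s u v I y"
  using sing_op_add[of s u v I x "- y"] sing_op_scaleR[of s u v I "-1" y] by simp

lemma sing_op_proj:
  assumes "orthonormal_on K v" "I \<subseteq> K" "J \<subseteq> K" "finite I" "finite J"
  shows "sing_op s u v I (proj v J x) = sing_op s u v (I \<inter> J) x"
proof -
  have "sing_op s u v I (proj v J x) = (\<Sum>i\<in>I. if i \<in> J then (s i * inner (v i) x) *\<^sub>R u i else 0)"
    unfolding sing_op_def[of s u v I] using assms
    by (intro sum.cong) (auto simp: inner_proj[OF assms(1,3,5)])
  then show ?thesis by (simp add: sum.inter_restrict assms(4) sing_op_def)
qed

lemma proj_sing_op:
  assumes "orthonormal_on K u" "I \<subseteq> K" "J \<subseteq> K" "finite I" "finite J"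
  shows "proj u I (sing_op s u v J x) = sing_op s u v (I \<inter> J) x"
proof -
  have "proj u I (sing_op s u v J x) = (\<Sum>i\<in>I. if i \<in> J then (s i * inner (v i) x) *\<^sub>R u i else 0)"
    unfolding proj_def[of u I] sing_op_def[of s u v J] using assms
    by (intro sum.cong) (auto simp: inner_lincomb[OF assms(1,3,5)])
  then show ?thesis by (simp add: sum.inter_restrict assms(4) sing_op_def)
qed

lemma norm_sing_op:
  "orthonormal_on I u \<Longrightarrow> finite I \<Longrightarrow>
    (norm (sing_op s u v I x))\<^sup>2 = (\<Sum>i\<in>I. (s i)\<^sup>2 * (inner (v i) x)\<^sup>2)"
  unfolding sing_op_def by (subst norm_lincomb) (simp_all add: power_mult_distrib)

lemma norm_sing_op_le:
  assumes "orthonormal_on I u" "orthonormal_on I v" "finite I"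
    and s: "\<And>i. i \<in> I \<Longrightarrow> 0 \<le> s i \<and> s i \<le> c" and "0 \<le> c"
  shows "norm (sing_op s u v I x) \<le> c * norm (proj v I x)"
proof (rule power2_le_imp_le)
  have "(\<Sum>i\<in>I. (s i)\<^sup>2 * (inner (v i) x)\<^sup>2) \<le> (\<Sum>i\<in>I. c\<^sup>2 * (inner (v i) x)\<^sup>2)"
    using s by (intro sum_mono mult_right_mono power_mono) auto
  then show "(norm (sing_op s u v I x))\<^sup>2 \<le> (c * norm (proj v I x))\<^sup>2"
    using assms by (simp add: norm_sing_op norm_proj power_mult_distrib sum_distrib_left)
qed (use assms in simp)

lemma norm_sing_op_ge:
  assumes "orthonormal_on I u" "orthonormal_on I v" "finite I"
    and s: "\<And>i. i \<in> I \<Longrightarrow> c \<le> s i" and "0 \<le> c"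
  shows "c * norm (proj v I x) \<le> norm (sing_op s u v I x)"
proof (rule power2_le_imp_le)
  have "(\<Sum>i\<in>I. c\<^sup>2 * (inner (v i) x)\<^sup>2) \<le> (\<Sum>i\<in>I. (s i)\<^sup>2 * (inner (v i) x)\<^sup>2)"
    using s assms(5) by (intro sum_mono mult_right_mono power_mono) auto
  then show "(c * norm (proj v I x))\<^sup>2 \<le> (norm (sing_op s u v I x))\<^sup>2"
    using assms by (simp add: norm_sing_op norm_proj power_mult_distrib sum_distrib_left)
qed simp

text \<open>The self-adjoint \<open>R\<close> moves from f_j to the singular vector v_i, after which
  the sum over j is a Bessel sum.\<close>

lemma sum_norm_sing_op_le:
  assumes "orthonormal_on I u" "finite I" "orthonormal_on J f" "finite J"
    and R: "\<And>x y. inner (R x) y = inner x (R y)"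
  shows "(\<Sum>j\<in>J. (norm (sing_op s u v I (R (f j))))\<^sup>2) \<le> (\<Sum>i\<in>I. (s i)\<^sup>2 * (norm (R (v i)))\<^sup>2)"
proof -
  have Rv: "inner (v i) (R (f j)) = inner (f j) (R (v i))" for i j
    by (rule trans[OF inner_commute R])
  have "(\<Sum>j\<in>J. (norm (sing_op s u v I (R (f j))))\<^sup>2)
      = (\<Sum>j\<in>J. \<Sum>i\<in>I. (s i)\<^sup>2 * (inner (f j) (R (v i)))\<^sup>2)"
    unfolding norm_sing_op[OF assms(1,2)] Rv ..
  also have "\<dots> = (\<Sum>i\<in>I. (s i)\<^sup>2 * (\<Sum>j\<in>J. (inner (f j) (R (v i)))\<^sup>2))"
    unfolding sum_distrib_left by (rule sum.swap)
  also have "\<dots> \<le> (\<Sum>i\<in>I. (s i)\<^sup>2 * (norm (R (v i)))\<^sup>2)"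
    by (intro sum_mono mult_left_mono bessel[OF assms(3,4)]) simp
  finally show ?thesis .
qed

text \<open>Expanding in \<open>w\<close> and passing to the transpose leaves f_j alone in an inner
  product, where Bessel's inequality removes it.\<close>

lemma sum_norm_proj_sing_op_le:
  assumes "orthonormal_on I v" "finite I" "orthonormal_on J f" "finite J"
    "orthonormal_on L w" "finite L"
  shows "(\<Sum>j\<in>J. (norm (proj w L (sing_op s u v I (f j))))\<^sup>2)
    \<le> (\<Sum>i\<in>I. (s i)\<^sup>2 * (norm (proj w L (u i)))\<^sup>2)"
proof -
  have "(\<Sum>j\<in>J. (norm (proj w L (sing_op s u v I (f j))))\<^sup>2)
      = (\<Sum>j\<in>J. \<Sum>l\<in>L. (inner (f j) (sing_op s v u I (w l)))\<^sup>2)"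
    by (simp add: norm_proj[OF assms(5,6)] sing_op_adjoint[of "w _" s u v])
  also have "\<dots> = (\<Sum>l\<in>L. \<Sum>j\<in>J. (inner (f j) (sing_op s v u I (w l)))\<^sup>2)"
    by (rule sum.swap)
  also have "\<dots> \<le> (\<Sum>l\<in>L. (norm (sing_op s v u I (w l)))\<^sup>2)"
    by (intro sum_mono bessel assms)
  also have "\<dots> = (\<Sum>l\<in>L. \<Sum>i\<in>I. (s i)\<^sup>2 * (inner (u i) (w l))\<^sup>2)"
    by (simp add: norm_sing_op[OF assms(1,2)])
  also have "\<dots> = (\<Sum>i\<in>I. (s i)\<^sup>2 * (\<Sum>l\<in>L. (inner (w l) (u i))\<^sup>2))"
    by (subst sum.swap) (simp add: sum_distrib_left inner_commute)
  finally show ?thesis by (simp add: norm_proj[OF assms(5,6)])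
qed

section \<open>Ky Fan's principles and dimension counting\<close>

text \<open>Bathtub principle: for decreasing \<open>a\<close>, a total mass c q with at most
  \<open>c\<close> per index does best when it fills the first q indices. Ky Fan's principles and
  the Frobenius estimates all reduce to it.\<close>

lemma weighted_sum_le:
  fixes a w :: "nat \<Rightarrow> real"
  assumes dec: "\<And>i j. p \<le> i \<Longrightarrow> i \<le> j \<Longrightarrow> j < k \<Longrightarrow> a j \<le> a i"
    and a: "\<And>i. p \<le> i \<Longrightarrow> i < k \<Longrightarrow> 0 \<le> a i"
    and w: "\<And>i. p \<le> i \<Longrightarrow> i < k \<Longrightarrow> 0 \<le> w i \<and> w i \<le> c"
    and sum_w: "(\<Sum>i=p..<k. w i) \<le> c * real q"
  shows "(\<Sum>i=p..<k. a i * w i) \<le> c * (\<Sum>i=p..<min (p + q) k. a i)"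
proof (cases "p + q < k")
  case False
  have "(\<Sum>i=p..<k. a i * w i) \<le> (\<Sum>i=p..<k. a i * c)"
    using a w by (intro sum_mono mult_left_mono) auto
  then show ?thesis using False by (simp add: sum_distrib_left mult.commute min_def not_less)
next
  case True
  \<comment> \<open>The threshold: \<open>a\<close> is at least \<open>h\<close> before p + q, where
    w - c is nonpositive, and at most \<open>h\<close> from there on. Replacing \<open>a\<close> by
    \<open>h\<close> therefore only increases the difference, and leaves \<open>h\<close> times the
    surplus of mass.\<close>
  define h where "h = a (p + q)"
  have split: "{p..<k} = {p..<p + q} \<union> {p + q..<k}" using True by auto
  have "(\<Sum>i=p..<k. a i * w i) - c * (\<Sum>i=p..<p + q. a i)
      = (\<Sum>i=p..<p + q. a i * (w i - c)) + (\<Sum>i=p + q..<k. a i * w i)"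
    unfolding split
    by (subst sum.union_disjoint)
      (auto simp: algebra_simps sum_subtractf sum_distrib_left)
  also have "\<dots> \<le> (\<Sum>i=p..<p + q. h * (w i - c)) + (\<Sum>i=p + q..<k. h * w i)"
    unfolding h_def using dec w True
    by (intro add_mono sum_mono mult_right_mono_neg mult_right_mono) auto
  also have "\<dots> = h * ((\<Sum>i=p..<k. w i) - c * real q)"
    unfolding split
    by (subst sum.union_disjoint)
      (auto simp: algebra_simps sum_subtractf sum_distrib_left)
  also have "\<dots> \<le> 0"
    using a[of "p + q"] sum_w True unfolding h_def by (intro mult_nonneg_nonpos) auto
  finally show ?thesis using True by (simp add: min_def)
qed

text \<open>Zero rows make the system square. As p < d the last row is zero, so the transpose
  annihilates the last unit vector and the determinant vanishes.\<close>

lemma underdetermined_system: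
  fixes c :: "nat \<Rightarrow> nat \<Rightarrow> real"
  assumes "p < d"
  obtains a where "\<exists>j<d. a j \<noteq> 0" "\<And>i. i < p \<Longrightarrow> (\<Sum>j<d. c i j * a j) = 0"
proof -
  define M where "M = mat d d (\<lambda>(i,j). if i < p then c i j else 0)"
  have M: "M \<in> carrier_mat d d" by (simp add: M_def)
  have "transpose_mat M *\<^sub>v unit_vec d (d - 1) = 0\<^sub>v d"
  proof (rule eq_vecI)
    fix i assume "i < dim_vec (0\<^sub>v d)"
    then show "(transpose_mat M *\<^sub>v unit_vec d (d - 1)) $ i = 0\<^sub>v d $ i"
      using assms by (simp add: M_def)
  qed (use M in simp)
  moreover have "unit_vec d (d - 1) \<noteq> (0\<^sub>v d :: real vec)"
    using assms by simp
  ultimately have "det (transpose_mat M) = 0"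
    using det_0_iff_vec_prod_zero_field[of "transpose_mat M" d] M
    by (metis transpose_carrier_mat unit_vec_carrier)
  then have "det M = 0" using det_transpose[OF M] by simp
  then obtain x where x: "x \<in> carrier_vec d" "x \<noteq> 0\<^sub>v d" "M *\<^sub>v x = 0\<^sub>v d"
    using det_0_iff_vec_prod_zero_field[OF M] by blast
  show ?thesis
  proof
    show "\<exists>j<d. x $ j \<noteq> 0" using x(1,2) by (metis carrier_vecD eq_vecI index_zero_vec)
    fix i assume "i < p"
    then have "(M *\<^sub>v x) $ i = (\<Sum>j<d. c i j * x $ j)"
      using assms x(1) by (auto simp: M_def scalar_prod_def lessThan_atLeast0 intro!: sum.cong)
    then show "(\<Sum>j<d. c i j * x $ j) = 0" using x(3) \<open>i < p\<close> assms by simp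
  qed
qed

text \<open>The vectors are chosen one at a time. The next one has d free coefficients and must
  satisfy r + q < d linear conditions, listed by \<open>b\<close>: orthogonality to v_l for l < r
  and to the q vectors already chosen.\<close>

lemma orthonormal_in_span_orthogonal:
  fixes v v' :: "nat \<Rightarrow> 'a::real_inner"
  assumes v': "orthonormal_on {..<d} v'" and "r + q \<le> d"
  shows "\<exists>z. orthonormal_on {..<q} z \<and> (\<forall>i<q. proj v' {..<d} (z i) = z i) \<and>
    (\<forall>i<q. \<forall>l<r. inner (v l) (z i) = 0)"
  using assms(2)
proof (induction q)
  case 0
  then show ?case by (simp add: orthonormal_on_def)
next
  case (Suc q)
  then obtain z where z: "orthonormal_on {..<q} z" "\<forall>i<q. proj v' {..<d} (z i) = z i"
    "\<forall>i<q. \<forall>l<r. inner (v l) (z i) = 0" by auto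
  define b where "b i = (if i < r then v i else z (i - r))" for i
  obtain a where a: "\<exists>j<d. a j \<noteq> 0"
    "\<And>i. i < r + q \<Longrightarrow> (\<Sum>j<d. inner (b i) (v' j) * a j) = 0"
    using underdetermined_system[of "r + q" d "\<lambda>i j. inner (b i) (v' j)"] Suc.prems by auto
  define x where "x = (\<Sum>j<d. a j *\<^sub>R v' j)"
  have bx: "inner (b i) x = 0" if "i < r + q" for i
    using a(2)[OF that] by (simp add: x_def inner_sum_right mult.commute)
  have "(norm x)\<^sup>2 = (\<Sum>j<d. (a j)\<^sup>2)"
    unfolding x_def by (rule norm_lincomb[OF v']) simp
  moreover have "(\<Sum>j<d. (a j)\<^sup>2) > 0"
    using a(1) by (auto intro: sum_pos2)
  ultimately have x0: "norm x > 0" by (metis less_irrefl norm_ge_zero order_le_less zero_power2)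
  define y where "y = inverse (norm x) *\<^sub>R x"
  have "proj v' {..<d} x = x"
    unfolding proj_def x_def
    by (intro sum.cong refl arg_cong2[where f = scaleR]) (simp add: inner_lincomb[OF v'])
  then have y: "proj v' {..<d} y = y" "inner y y = 1"
    using x0 by (auto simp: y_def proj_scaleR dot_square_norm power2_eq_square)
  have yv: "inner (v l) y = 0" if "l < r" for l
    using bx[of l] that by (simp add: b_def y_def)
  have yz: "inner (z l) y = 0" if "l < q" for l
    using bx[of "r + l"] that by (simp add: b_def y_def)
  then have yz': "inner y (z l) = 0" if "l < q" for l
    using that by (simp add: inner_commute)
  have on: "orthonormal_on {..<Suc q} (z(q := y))"
    using z(1) y(2) yz yz' by (auto simp: orthonormal_on_def less_Suc_eq)
  show ?case
    by (rule exI[of _ "z(q := y)"], intro conjI on) (use z y yv in \<open>auto simp: less_Suc_eq\<close>)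
qed

lemma sing_op_orthogonal:
  assumes "\<And>l. l < r \<Longrightarrow> inner (v l) x = 0"
  shows "sing_op s u v {..<k} x = sing_op s u v {r..<k} x"
  unfolding sing_op_def using assms
  by (intro sum.mono_neutral_right) auto

lemma sing_op_split:
  assumes "r \<le> k"
  shows "sing_op s u v {..<k} x = sing_op s u v {..<r} x + sing_op s u v {r..<k} x"
proof -
  have "{..<k} = {..<r} \<union> {r..<k}" using assms by auto
  then show ?thesis unfolding sing_op_def by (simp add: sum.union_disjoint ivl_disj_int)
qed

text \<open>Ky Fan's minimum principle inside the span of the first d right vectors. The masses w_l
  lie in [0,1] and total exactly q, so the complementary masses 1 - w_l total d - q; the bathtub
  principle applied to these shows that at most the d - q largest squares are lost.\<close>

lemma sum_norm_sing_op_ge: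
  assumes u: "orthonormal_on {..<k} u" and v: "orthonormal_on {..<k} v"
    and s: "\<And>i. i < k \<Longrightarrow> 0 \<le> s i" "\<And>i j. i \<le> j \<Longrightarrow> j < k \<Longrightarrow> s j \<le> s i"
    and z: "orthonormal_on {..<q} z" "\<And>i. i < q \<Longrightarrow> proj v {..<d} (z i) = z i"
    and dk: "d \<le> k" and qd: "q \<le> d"
  shows "(\<Sum>l=d-q..<d. (s l)\<^sup>2) \<le> (\<Sum>i<q. (norm (sing_op s u v {..<k} (z i)))\<^sup>2)"
proof -
  have ud: "orthonormal_on {..<d} u" and vd: "orthonormal_on {..<d} v"
    using u v dk by (auto intro: orthonormal_on_subset)
  define w where "w l = (norm (proj z {..<q} (v l)))\<^sup>2" for l
  have kd: "{..<k} \<inter> {..<d} = {..<d}" using dk by auto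
  have "sing_op s u v {..<k} (z i) = sing_op s u v {..<d} (z i)" if "i < q" for i
    using sing_op_proj[OF v, of "{..<k}" "{..<d}" s u "z i"] z(2)[OF that] dk
    by (simp add: kd)
  then have "(\<Sum>i<q. (norm (sing_op s u v {..<k} (z i)))\<^sup>2)
      = (\<Sum>i<q. \<Sum>l<d. (s l)\<^sup>2 * (inner (v l) (z i))\<^sup>2)"
    by (simp add: norm_sing_op[OF ud])
  also have "\<dots> = (\<Sum>l<d. (s l)\<^sup>2 * w l)"
    by (subst sum.swap) (simp add: w_def norm_proj[OF z(1)] sum_distrib_left inner_commute)
  finally have eq: "(\<Sum>i<q. (norm (sing_op s u v {..<k} (z i)))\<^sup>2) = (\<Sum>l<d. (s l)\<^sup>2 * w l)" .
  have "(\<Sum>l<d. w l) = (\<Sum>i<q. (norm (proj v {..<d} (z i)))\<^sup>2)"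
    unfolding w_def by (rule sum_norm_proj_swap[OF vd _ z(1)]) auto
  also have "\<dots> = (\<Sum>i<q. 1)"
    using z by (intro sum.cong) (auto simp: power2_norm_eq_inner orthonormal_on_def)
  finally have sw: "(\<Sum>l<d. w l) = real q" by simp
  have w1: "0 \<le> w l \<and> w l \<le> 1" if "l < d" for l
  proof -
    have "norm (v l) = 1" using v that dk by (simp add: orthonormal_on_def norm_eq_sqrt_inner)
    then have "norm (proj z {..<q} (v l)) \<le> 1"
      using norm_proj_le(1)[OF z(1), of "v l"] by simp
    then show ?thesis by (simp add: w_def power_le_one)
  qed
  have "(\<Sum>l=0..<d. (s l)\<^sup>2 * (1 - w l)) \<le> 1 * (\<Sum>l=0..<min (0 + (d - q)) d. (s l)\<^sup>2)"
  proof (rule weighted_sum_le)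
    show "(\<Sum>l=0..<d. 1 - w l) \<le> 1 * real (d - q)"
      using sw qd by (simp add: sum_subtractf atLeast0LessThan of_nat_diff)
  qed (use s w1 dk in \<open>auto intro!: power_mono\<close>)
  then have "(\<Sum>l<d. (s l)\<^sup>2) - (\<Sum>l<d. (s l)\<^sup>2 * w l) \<le> (\<Sum>l<d - q. (s l)\<^sup>2)"
    by (simp add: atLeast0LessThan algebra_simps sum_subtractf)
  moreover have "(\<Sum>l<d. (s l)\<^sup>2) = (\<Sum>l<d - q. (s l)\<^sup>2) + (\<Sum>l=d-q..<d. (s l)\<^sup>2)"
    using sum.atLeastLessThan_concat[of 0 "d - q" d "\<lambda>l. (s l)\<^sup>2"] by (simp add: atLeast0LessThan)
  ultimately show ?thesis unfolding eq by simp
qed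

text \<open>Ky Fan's maximum principle, stated for a tail: q orthonormal vectors put mass at most 1
  on each v_l and at most q on all of them.\<close>

lemma sum_norm_sing_op_tail_le:
  assumes u: "orthonormal_on {..<k} u" and v: "orthonormal_on {..<k} v"
    and s: "\<And>i. i < k \<Longrightarrow> 0 \<le> s i" "\<And>i j. i \<le> j \<Longrightarrow> j < k \<Longrightarrow> s j \<le> s i"
    and z: "orthonormal_on {..<q} z"
  shows "(\<Sum>i<q. (norm (sing_op s u v {p..<k} (z i)))\<^sup>2) \<le> (\<Sum>l=p..<min (p + q) k. (s l)\<^sup>2)"
proof -
  have up: "orthonormal_on {p..<k} u" and vp: "orthonormal_on {p..<k} v"
    using u v by (auto intro: orthonormal_on_subset)
  define w where "w l = (norm (proj z {..<q} (v l)))\<^sup>2" for l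
  have "(\<Sum>i<q. (norm (sing_op s u v {p..<k} (z i)))\<^sup>2)
      = (\<Sum>i<q. \<Sum>l=p..<k. (s l)\<^sup>2 * (inner (v l) (z i))\<^sup>2)"
    by (simp add: norm_sing_op[OF up])
  also have "\<dots> = (\<Sum>l=p..<k. (s l)\<^sup>2 * w l)"
    by (subst sum.swap) (simp add: w_def norm_proj[OF z] sum_distrib_left inner_commute)
  also have "\<dots> \<le> 1 * (\<Sum>l=p..<min (p + q) k. (s l)\<^sup>2)"
  proof (rule weighted_sum_le)
    fix l assume l: "p \<le> l" "l < k"
    then have "norm (v l) = 1" using v by (simp add: orthonormal_on_def norm_eq_sqrt_inner)
    then have "norm (proj z {..<q} (v l)) \<le> 1"
      using norm_proj_le(1)[OF z, of "v l"] by simp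
    then show "0 \<le> w l \<and> w l \<le> 1" by (simp add: w_def power_le_one)
  next
    have "(\<Sum>l=p..<k. w l) = (\<Sum>i<q. (norm (proj v {p..<k} (z i)))\<^sup>2)"
      unfolding w_def by (rule sum_norm_proj_swap[OF vp _ z]) auto
    also have "\<dots> \<le> (\<Sum>i<q. (norm (z i))\<^sup>2)"
      by (intro sum_mono power_mono norm_proj_le(1)[OF vp]) auto
    also have "\<dots> = real q"
      using z by (simp add: power2_norm_eq_inner orthonormal_on_def)
    finally show "(\<Sum>l=p..<k. w l) \<le> 1 * real q" by simp
  qed (use s in \<open>auto intro!: power_mono\<close>)
  finally show ?thesis by simp
qed

section \<open>Perturbation of singular values and singular subspaces\<close>

text \<open>The two matrices enter only through their decompositions and the bound \<open>e\<close>
  on the difference. These hypotheses survive exchanging the matrices and transposing both, so an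
  estimate proved once is available in four versions by interpretation.\<close>

locale sing_pair =
  fixes s :: "nat \<Rightarrow> real" and u :: "nat \<Rightarrow> 'a::real_inner" and v :: "nat \<Rightarrow> 'b::real_inner"
    and s' :: "nat \<Rightarrow> real" and u' :: "nat \<Rightarrow> 'a" and v' :: "nat \<Rightarrow> 'b"
    and k :: nat and e :: real
  assumes u: "orthonormal_on {..<k} u" and v: "orthonormal_on {..<k} v"
    and u': "orthonormal_on {..<k} u'" and v': "orthonormal_on {..<k} v'"
    and s_nonneg: "\<And>i. i < k \<Longrightarrow> 0 \<le> s i"
    and s_antimono: "\<And>i j. i \<le> j \<Longrightarrow> j < k \<Longrightarrow> s j \<le> s i"
    and s'_nonneg: "\<And>i. i < k \<Longrightarrow> 0 \<le> s' i"
    and s'_antimono: "\<And>i j. i \<le> j \<Longrightarrow> j < k \<Longrightarrow> s' j \<le> s' i"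
    and e_nonneg: "0 \<le> e"
    and close: "\<And>x. norm (sing_op s' u' v' {..<k} x - sing_op s u v {..<k} x) \<le> e * norm x"

lemma sing_pair_swap: "sing_pair s u v s' u' v' k e \<Longrightarrow> sing_pair s' u' v' s u v k e"
  unfolding sing_pair_def by (auto simp: norm_minus_commute)

text \<open>An operator and its adjoint have the same norm: for x the image of y under the
  transposed difference, the inner product of y with the difference at x is ||x||^2, and
  Cauchy-Schwarz applies.\<close>

lemma sing_pair_dual:
  assumes "sing_pair s u v s' u' v' k e"
  shows "sing_pair s v u s' v' u' k e"
proof -
  interpret sing_pair s u v s' u' v' k e by fact
  have "norm (sing_op s' v' u' {..<k} y - sing_op s v u {..<k} y) \<le> e * norm y" for y
  proof -
    define x where "x = sing_op s' v' u' {..<k} y - sing_op s v u {..<k} y"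
    have "inner y (sing_op s' u' v' {..<k} x - sing_op s u v {..<k} x) = inner x x"
      by (simp add: x_def inner_diff_right sing_op_adjoint[of y])
    then have "norm x * norm x \<le> norm y * (e * norm x)"
      using norm_cauchy_schwarz[of y "sing_op s' u' v' {..<k} x - sing_op s u v {..<k} x"]
        mult_left_mono[OF close[of x], of "norm y"]
      by (simp add: dot_square_norm power2_eq_square)
    then have "norm x * norm x \<le> (e * norm y) * norm x" by (simp add: mult_ac)
    then show ?thesis
      using e_nonneg unfolding x_def[symmetric]
      by (cases "norm x = 0") (auto simp: mult_le_cancel_right)
  qed
  then show ?thesis
    using u v u' v' s_nonneg s_antimono s'_nonneg s'_antimono e_nonneg
    by (unfold_locales) auto
qed

context sing_pair
begin

lemma orthonormal_sub:
  assumes "I \<subseteq> {..<k}"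
  shows "orthonormal_on I u" "orthonormal_on I v" "orthonormal_on I u'" "orthonormal_on I v'"
  using u v u' v' assms by (auto intro: orthonormal_on_subset)

lemma norm_tail_le:
  assumes "r < k"
  shows "norm (sing_op s u v {r..<k} x) \<le> s r * norm (proj v {r..<k} x)"
    "norm (sing_op s u v {r..<k} x) \<le> s r * norm x"
proof -
  show 1: "norm (sing_op s u v {r..<k} x) \<le> s r * norm (proj v {r..<k} x)" for x
    using assms s_nonneg s_antimono
    by (intro norm_sing_op_le orthonormal_sub) auto
  show "norm (sing_op s u v {r..<k} x) \<le> s r * norm x"
    by (rule order_trans[OF 1]) (use assms s_nonneg in \<open>auto intro!: mult_left_mono norm_proj_le orthonormal_sub\<close>)
qed

lemma norm_close: "norm (sing_op s' u' v' {..<k} x) \<le> norm (sing_op s u v {..<k} x) + e * norm x"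
  using norm_triangle_sub[of "sing_op s' u' v' {..<k} x" "sing_op s u v {..<k} x"] close[of x] by linarith

text \<open>One test vector suffices: a unit vector in the span of v'_0, ..., v'_i orthogonal to
  v_0, ..., v_{i-1} is stretched by at least s'_i under one operator and by at most s_i under the
  other.\<close>

lemma weyl:
  assumes "i < k"
  shows "s' i \<le> s i + e"
proof -
  obtain z where z: "orthonormal_on {..<1} z" "\<forall>j<1. proj v' {..<Suc i} (z j) = z j"
    "\<forall>j<1. \<forall>l<i. inner (v l) (z j) = 0"
    using orthonormal_in_span_orthogonal[of "Suc i" v' i 1 v] orthonormal_sub(4)[of "{..<Suc i}"] assms
    by auto
  have nz: "norm (z 0) = 1"
    using z(1) by (simp add: orthonormal_on_def norm_eq_sqrt_inner)
  have "(s' i)\<^sup>2 \<le> (norm (sing_op s' u' v' {..<k} (z 0)))\<^sup>2"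
    using sum_norm_sing_op_ge[OF u' v' s'_nonneg s'_antimono z(1), where d = "Suc i"] z(2) assms by simp
  then have "s' i \<le> norm (sing_op s' u' v' {..<k} (z 0))"
    by (rule power2_le_imp_le) simp
  also have "\<dots> \<le> norm (sing_op s u v {i..<k} (z 0)) + e"
    using norm_close[of "z 0"] nz sing_op_orthogonal[of i v "z 0" s u k] z(3) by simp
  also have "\<dots> \<le> s i + e"
    using norm_tail_le(2)[OF assms, of "z 0"] nz by simp
  finally show ?thesis .
qed

text \<open>The same q = d - r test vectors serve for all three operators: they lie in the span of
  the first d vectors v' and are orthogonal to the first r vectors v. As d - q = r, the minimum
  principle yields exactly the values of s' from r to d - 1; the maximum principle bounds the other
  two sums.\<close>

lemma tail_sum_le:
  assumes t: "orthonormal_on {..<k} w" "orthonormal_on {..<k} y"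
      "\<And>i. i < k \<Longrightarrow> 0 \<le> t i" "\<And>i j. i \<le> j \<Longrightarrow> j < k \<Longrightarrow> t j \<le> t i"
    and eq: "\<And>x. sing_op s' u' v' {..<k} x = sing_op s u v {..<k} x + sing_op t w y {..<k} x"
    and r: "r \<le> k"
  shows "L2_set s' {r..<min (r + r) k} \<le> L2_set s {r..<min (r + r) k} + L2_set t {..<r}"
proof -
  define d where "d = min (r + r) k"
  define q where "q = d - r"
  have dq: "d \<le> k" "r + q = d" "q \<le> r" "d - q = r" "q \<le> d" using r by (auto simp: d_def q_def)
  obtain z where z: "orthonormal_on {..<q} z" "\<forall>i<q. proj v' {..<d} (z i) = z i"
    "\<forall>i<q. \<forall>l<r. inner (v l) (z i) = 0"
    using orthonormal_in_span_orthogonal[of d v' r q v] orthonormal_sub(4)[of "{..<d}"] dq by auto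
  have "L2_set s' {r..<d} \<le> L2_set (\<lambda>i. norm (sing_op s' u' v' {..<k} (z i))) {..<q}"
    unfolding L2_set_def
    using sum_norm_sing_op_ge[OF u' v' s'_nonneg s'_antimono z(1), where d = d] z(2) dq by simp
  also have "\<dots> \<le> L2_set (\<lambda>i. norm (sing_op s u v {r..<k} (z i)) + norm (sing_op t w y {..<k} (z i))) {..<q}"
    using z(3) sing_op_orthogonal[of r v "z _" s u k]
    by (intro L2_set_mono) (auto simp: eq intro: norm_triangle_ineq)
  also have "\<dots> \<le> L2_set (\<lambda>i. norm (sing_op s u v {r..<k} (z i))) {..<q}
      + L2_set (\<lambda>i. norm (sing_op t w y {..<k} (z i))) {..<q}"
    by (rule L2_set_triangle_ineq)
  also have "\<dots> \<le> L2_set s {r..<d} + L2_set t {..<r}"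
  proof (rule add_mono)
    show "L2_set (\<lambda>i. norm (sing_op s u v {r..<k} (z i))) {..<q} \<le> L2_set s {r..<d}"
      unfolding L2_set_def
      using sum_norm_sing_op_tail_le[OF u v s_nonneg s_antimono z(1), where p = r] dq by (simp add: min_absorb1)
    have "(\<Sum>i<q. (norm (sing_op t w y {..<k} (z i)))\<^sup>2) \<le> (\<Sum>l<min q k. (t l)\<^sup>2)"
      using sum_norm_sing_op_tail_le[OF t z(1), where p = 0] by (simp add: atLeast0LessThan)
    also have "\<dots> \<le> (\<Sum>l<r. (t l)\<^sup>2)"
      using dq by (intro sum_mono2) auto
    finally show "L2_set (\<lambda>i. norm (sing_op t w y {..<k} (z i))) {..<q} \<le> L2_set t {..<r}"
      unfolding L2_set_def by simp
  qed
  finally show ?thesis unfolding d_def .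
qed

section \<open>Angles between singular subspaces\<close>

text \<open>Half of the feedback: a bound on left angles gives one on right angles. The dual
  instance leads back.\<close>

lemma wedin_step:
  assumes r: "1 \<le> r" "r < k" and t0: "0 \<le> t"
    and t: "\<And>x. norm (proj u' {..<r} (proj u {r..<k} x)) \<le> t * norm x"
  shows "s' (r - 1) * norm (proj v' {..<r} (proj v {r..<k} x)) \<le> (s r * t + e) * norm x"
proof -
  define z where "z = proj v {r..<k} x"
  have I: "{..<r} \<inter> {..<k} = {..<r}" "{r..<k} \<inter> {..<k} = {r..<k}" "{..<k} \<inter> {r..<k} = {r..<k}"
    using r by auto
  have sub: "{r..<k} \<subseteq> {..<k}" by auto
  have zx: "norm z \<le> norm x" unfolding z_def by (intro norm_proj_le orthonormal_sub) auto
  have Az: "sing_op s u v {..<k} z = sing_op s u v {r..<k} x"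
    unfolding z_def using sing_op_proj[OF v order_refl sub, of s u x] by (simp add: I)
  have Az': "proj u {r..<k} (sing_op s u v {r..<k} x) = sing_op s u v {r..<k} x"
    using proj_sing_op[OF u sub sub, of s v x] by simp
  have "s' (r - 1) * norm (proj v' {..<r} z) \<le> norm (sing_op s' u' v' {..<r} z)"
    using r s'_nonneg s'_antimono by (intro norm_sing_op_ge orthonormal_sub) auto
  also have "sing_op s' u' v' {..<r} z = proj u' {..<r} (sing_op s' u' v' {..<k} z)"
    using proj_sing_op[OF u', of "{..<r}" "{..<k}" s' v' z] r by (simp add: I)
  also have "\<dots> = proj u' {..<r} (sing_op s' u' v' {..<k} z - sing_op s u v {..<k} z)
      + proj u' {..<r} (proj u {r..<k} (sing_op s u v {r..<k} x))"
    by (simp add: Az Az' proj_diff)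
  also have "norm \<dots> \<le> e * norm z + t * norm (sing_op s u v {r..<k} x)"
  proof (rule norm_triangle_mono[OF _ t])
    have "norm (proj u' {..<r} (sing_op s' u' v' {..<k} z - sing_op s u v {..<k} z))
        \<le> norm (sing_op s' u' v' {..<k} z - sing_op s u v {..<k} z)"
      using r by (intro norm_proj_le orthonormal_sub) auto
    also have "\<dots> \<le> e * norm z" by (rule close)
    finally show "norm (proj u' {..<r} (sing_op s' u' v' {..<k} z - sing_op s u v {..<k} z)) \<le> e * norm z" .
  qed
  also have "\<dots> \<le> e * norm x + t * (s r * norm x)"
  proof (rule add_mono)
    show "e * norm z \<le> e * norm x" using zx e_nonneg by (rule mult_left_mono)
    show "t * norm (sing_op s u v {r..<k} x) \<le> t * (s r * norm x)"
      using norm_tail_le(2)[OF r(2), of x] t0 by (rule mult_left_mono)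
  qed
  finally show ?thesis by (simp add: z_def algebra_simps)
qed

end
context sing_pair
begin

text \<open>The infimum \<open>t\<close> of the common bounds for both sides stands for the larger
  of the two operator norms. The step turns \<open>t\<close> into the common bound (s_r t + e) /
  s'_{r-1}, which is therefore at least \<open>t\<close>; solving for \<open>t\<close> gives the
  claim.\<close>

lemma wedin:
  assumes r: "1 \<le> r" "r < k" and sep: "s r < s' (r - 1)"
  shows "norm (proj u' {..<r} (proj u {r..<k} x)) \<le> e / (s' (r - 1) - s r) * norm x"
proof -
  interpret dual: sing_pair s v u s' v' u' k e
    by (rule sing_pair_dual) unfold_locales
  define T where "T = {t. 0 \<le> t \<and> (\<forall>x. norm (proj u' {..<r} (proj u {r..<k} x)) \<le> t * norm x)
    \<and> (\<forall>x. norm (proj v' {..<r} (proj v {r..<k} x)) \<le> t * norm x)}"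
  have pos: "0 < s' (r - 1)" using sep s_nonneg[OF r(2)] by linarith
  have bdd: "bdd_below T" by (rule bdd_belowI[of _ 0]) (simp add: T_def)
  have "norm (proj u' {..<r} (proj u {r..<k} x)) \<le> norm x"
    "norm (proj v' {..<r} (proj v {r..<k} y)) \<le> norm y" for x y
    using r by (auto intro!: norm_proj_proj_le orthonormal_sub)
  then have 1: "1 \<in> T" by (simp add: T_def)
  then have ne: "T \<noteq> {}" by blast
  define t where "t = Inf T"
  have t0: "0 \<le> t" unfolding t_def using ne by (rule cInf_greatest) (simp add: T_def)
  \<comment> \<open>The infimum is itself a bound, so the step may be applied to it.\<close>
  have inf_bound: "c \<le> t * n" if "\<And>t. t \<in> T \<Longrightarrow> c \<le> t * n" "0 \<le> n" for c n
  proof (cases "n = 0")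
    case True
    then show ?thesis using that(1)[OF 1] by simp
  next
    case False
    then have "c / n \<le> t" unfolding t_def
      using 1 that by (intro cInf_greatest) (auto simp: divide_le_eq)
    then show ?thesis using False that(2) by (simp add: divide_le_eq)
  qed
  have tu: "norm (proj u' {..<r} (proj u {r..<k} x)) \<le> t * norm x" for x
    by (rule inf_bound) (auto simp: T_def)
  have tv: "norm (proj v' {..<r} (proj v {r..<k} x)) \<le> t * norm x" for x
    by (rule inf_bound) (auto simp: T_def)
  have "(s r * t + e) / s' (r - 1) \<in> T"
    using wedin_step[OF r t0 tu] dual.wedin_step[OF r t0 tv] pos s_nonneg[OF r(2)] t0 e_nonneg
    by (auto simp: T_def divide_simps mult.commute)
  then have "t \<le> (s r * t + e) / s' (r - 1)" unfolding t_def using bdd by (rule cInf_lower)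
  then have "t \<le> e / (s' (r - 1) - s r)" using pos sep by (simp add: field_simps)
  then show ?thesis using tu[of x] mult_right_mono[of t _ "norm x"] by force
qed

text \<open>The denominator in \<open>wedin\<close> mixes singular values of both matrices. By Weyl,
  replacing s' by s costs at most e, less than half the gap; the half that remains accounts for the
  factor 2 in \<open>g\<close>.\<close>

lemma sin_theta:
  assumes r: "1 \<le> r" "r < k"
    and g: "g = (if 2 * e < s (r - 1) - s r then 2 * e / (s (r - 1) - s r) else 1)"
  shows "norm (proj u' {..<r} (proj u {r..<k} x)) \<le> g * norm x"
    and "norm (proj u {..<r} (proj u' {r..<k} x)) \<le> g * norm x"
proof -
  interpret swap: sing_pair s' u' v' s u v k e
    by (rule sing_pair_swap) unfold_locales
  have "norm (proj u' {..<r} (proj u {r..<k} x)) \<le> g * norm x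
    \<and> norm (proj u {..<r} (proj u' {r..<k} x)) \<le> g * norm x"
  proof (cases "2 * e < s (r - 1) - s r")
    case False
    have "norm (proj u' {..<r} (proj u {r..<k} x)) \<le> norm x"
      "norm (proj u {..<r} (proj u' {r..<k} x)) \<le> norm x"
      using r by (auto intro!: norm_proj_proj_le orthonormal_sub)
    then show ?thesis using False g by simp
  next
    case True
    have "s (r - 1) \<le> s' (r - 1) + e" "s' r \<le> s r + e"
      using swap.weyl[of "r - 1"] weyl[of r] r by auto
    then have d: "(s (r - 1) - s r) / 2 \<le> s' (r - 1) - s r" "(s (r - 1) - s r) / 2 \<le> s (r - 1) - s' r"
      "0 < s (r - 1) - s r" using True e_nonneg by auto
    have b: "e / c \<le> g" if "(s (r - 1) - s r) / 2 \<le> c" for c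
      using True g divide_left_mono[OF that e_nonneg] that d(3) by (simp add: mult.commute)
    have sep: "s r < s' (r - 1)" "s' r < s (r - 1)" using d by auto
    show ?thesis
      using order_trans[OF wedin[OF r sep(1), of x] mult_right_mono[OF b[OF d(1)]]]
        order_trans[OF swap.wedin[OF r sep(2), of x] mult_right_mono[OF b[OF d(2)]]] by simp
  qed
  then show "norm (proj u' {..<r} (proj u {r..<k} x)) \<le> g * norm x"
    and "norm (proj u {..<r} (proj u' {r..<k} x)) \<le> g * norm x" by auto
qed

text \<open>
  Let \<open>x\<close> be a unit vector of \<open>W = span {u i | i < r}\<close> at which the form \<open>\<langle>x, J x\<rangle>\<close>, \<open>J\<close> being the
  reflection \<open>2 P - 1\<close>, is smallest. Then \<open>J x = \<mu> x + z\<close> with \<open>z\<close> orthogonal to \<open>W\<close>. The form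
  \<open>\<Theta>\<close> is positive on \<open>W\<close>, nonpositive on its complement and invariant under \<open>J\<close>, and
  \<open>\<Theta> x (J x) \<ge> 0\<close>; if \<open>\<mu> < 0\<close> this makes \<open>\<Theta> z z\<close> positive, a contradiction. Instead of an
  exact minimiser, whose existence would need compactness, the proof uses that for every unit
  \<open>y\<close> of \<open>W\<close> the component \<open>w\<close> of \<open>J y - \<mu> y\<close> in \<open>W\<close> is bounded below, which makes
  \<open>\<langle>y, J y\<rangle>\<close> exceed its infimum \<open>\<mu>\<close> by a fixed amount.
\<close>

lemma acute:
  assumes r: "1 \<le> r" "r < k" and sep: "2 * e < s (r - 1) - s r"
    and x: "proj u {..<r} x = x"
  shows "norm (x - proj u' {..<r} x) \<le> norm (proj u' {..<r} x)"
proof (rule ccontr)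
  assume neg: "\<not> ?thesis"
  interpret dual: sing_pair s v u s' v' u' k e
    by (rule sing_pair_dual) unfold_locales
  interpret swap: sing_pair s' v' u' s v u k e
    by (rule sing_pair_swap) unfold_locales
  have Ik: "{..<r} \<subseteq> {..<k}" "{r..<k} \<subseteq> {..<k}" "{..<k} \<inter> {..<r} = {..<r}"
    "{r..<k} \<inter> {..<r} = {}" "{..<r} \<inter> {r..<k} = {}" using r by auto
  note on = orthonormal_sub[OF Ik(1)] orthonormal_sub[OF Ik(2)]
  define P where "P = proj u' {..<r}"
  define J where "J y = 2 *\<^sub>R P y - y" for y
  define T where "T = sing_op s' v' u' {..<k}"
  define T1 where "T1 = sing_op s' v' u' {..<r}"
  define T2 where "T2 = sing_op s' v' u' {r..<k}"
  \<comment> \<open>The condition on the gap says exactly that \<open>\<nu>\<close> <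
    \<open>\<kappa>\<close>. By Weyl \<open>\<nu>\<close> also separates s'_r from s'_{r-1}, which
    gives the sign of \<open>\<Theta> y (J y)\<close>; on W the operator \<open>T\<close> stretches
    by at least \<open>\<kappa>\<close>, on its complement by at most \<open>\<nu>\<close>.\<close>
  define \<nu> where "\<nu> = s r + e"
  define \<kappa> where "\<kappa> = s (r - 1) - e"
  define \<Theta> where "\<Theta> a b = inner (T a) (T b) - \<nu>\<^sup>2 * inner a b" for a b
  have \<nu>\<kappa>: "0 \<le> \<nu>" "\<nu> < \<kappa>" using sep s_nonneg[OF r(2)] e_nonneg by (auto simp: \<nu>_def \<kappa>_def)
  have s'r: "s' r \<le> \<nu>" using weyl[OF r(2)] by (simp add: \<nu>_def)
  have s'r1: "\<nu> \<le> s' i" if "i < r" for i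
  proof -
    have "r - 1 < k" "i \<le> r - 1" using that r by auto
    then show ?thesis
      using swap.weyl[of "r - 1"] s'_antimono[of i "r - 1"] \<nu>\<kappa> by (simp add: \<kappa>_def)
  qed
  have Tlin: "T (a + b) = T a + T b" "T (a - b) = T a - T b" "T (c *\<^sub>R a) = c *\<^sub>R T a" for a b c
    by (simp_all add: T_def sing_op_add sing_op_diff sing_op_scaleR)
  have T12: "T y = T1 y + T2 y" for y
    unfolding T_def T1_def T2_def using r by (intro sing_op_split) simp
  have TP: "T (P y) = T1 y" for y
    unfolding T_def T1_def P_def by (simp add: sing_op_proj[OF u' order_refl Ik(1)] Ik)
  have T1T2: "inner (T1 a) (T2 b) = 0" for a b
    unfolding T1_def T2_def sing_op_def
    by (subst inner_lincomb_lincomb[OF v' Ik(1) _ Ik(2)]) (auto simp: Ik)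
  then have T2T1: "inner (T2 a) (T1 b) = 0" for a b by (metis inner_commute)
  have TJ: "T (J y) = T1 y - T2 y" for y
    by (simp add: J_def Tlin TP scaleR_2) (simp add: T12)
  have TJJ: "inner (T (J a)) (T (J b)) = inner (T a) (T b)" for a b
    unfolding TJ by (simp add: T12 inner_add inner_diff T1T2 T2T1)
  have PP: "P (P y) = P y" for y unfolding P_def by (rule proj_idem[OF on(3)]) simp
  have PS: "inner (P a) b = inner a (P b)" for a b unfolding P_def by (rule proj_self_adjoint)
  have JJ: "inner (J a) (J b) = inner a b" for a b
    by (simp add: J_def inner_diff PS PP)
  have JS: "inner (J a) b = inner a (J b)" for a b
    by (simp add: J_def inner_diff PS)
  have Jlin: "J (a + b) = J a + J b" "J (c *\<^sub>R a) = c *\<^sub>R J a" for a b c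
    by (simp_all add: J_def P_def proj_add proj_scaleR algebra_simps)
  have normJ: "norm (J a) = norm a" for a using JJ[of a a] by (simp add: norm_eq_sqrt_inner)
  have xJx: "inner y (J y) = (norm (P y))\<^sup>2 - (norm (y - P y))\<^sup>2" for y
    by (simp add: J_def power2_norm_eq_inner inner_diff PS PP inner_commute[of "P y" y])
  have \<Theta>J: "\<Theta> (J a) (J b) = \<Theta> a b" for a b by (simp add: \<Theta>_def TJJ JJ)
  have \<Theta>xJ: "0 \<le> \<Theta> y (J y)" for y
  proof -
    have "inner (T y) (T (J y)) = (norm (T1 y))\<^sup>2 - (norm (T2 y))\<^sup>2"
      unfolding TJ by (simp add: T12 inner_add inner_diff T1T2 T2T1 power2_norm_eq_inner)
    moreover have "(\<nu> * norm (P y))\<^sup>2 \<le> (norm (T1 y))\<^sup>2"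
      unfolding T1_def P_def using \<nu>\<kappa>(1) s'r1
      by (intro power_mono norm_sing_op_ge on) auto
    moreover have "(norm (T2 y))\<^sup>2 \<le> (\<nu> * norm (y - P y))\<^sup>2"
    proof (rule power_mono)
      have "T2 y = T2 (y - P y)"
        unfolding T2_def P_def sing_op_diff
        by (simp add: sing_op_proj[OF u' Ik(2,1)] Ik) (simp add: sing_op_def)
      also have "norm \<dots> \<le> s' r * norm (y - P y)"
        unfolding T2_def by (rule swap.norm_tail_le(2)[OF r(2)])
      also have "\<dots> \<le> \<nu> * norm (y - P y)" using s'r by (rule mult_right_mono) simp
      finally show "norm (T2 y) \<le> \<nu> * norm (y - P y)" .
    qed simp
    ultimately show ?thesis by (simp add: \<Theta>_def xJx power_mult_distrib algebra_simps)
  qed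
  have \<Theta>lin: "\<Theta> (a + c *\<^sub>R b) (a + c *\<^sub>R b) = \<Theta> a a + 2 * c * \<Theta> a b + c\<^sup>2 * \<Theta> b b" for a b c
    by (simp add: \<Theta>_def Tlin inner_add inner_commute[of "T b" "T a"] inner_commute[of b a]
        algebra_simps power2_eq_square)
  define C where "C = (s' 0)\<^sup>2 + \<nu>\<^sup>2"
  have \<Theta>C: "\<bar>\<Theta> a b\<bar> \<le> C * (norm a * norm b)" for a b
  proof -
    have T: "norm (T y) \<le> s' 0 * norm y" for y
      using swap.norm_tail_le(2)[of 0 y] r by (simp add: T_def atLeast0LessThan)
    have "\<bar>inner (T a) (T b)\<bar> \<le> (s' 0 * norm a) * (s' 0 * norm b)"
      using s'_nonneg[of 0] r by (intro order_trans[OF Cauchy_Schwarz_ineq2] mult_mono T) auto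
    moreover have "\<bar>\<nu>\<^sup>2 * inner a b\<bar> \<le> \<nu>\<^sup>2 * (norm a * norm b)"
      by (simp add: abs_mult mult_left_mono Cauchy_Schwarz_ineq2)
    ultimately show ?thesis
      unfolding \<Theta>_def C_def by (simp add: algebra_simps power2_eq_square)
  qed
  define \<delta> where "\<delta> = \<kappa>\<^sup>2 - \<nu>\<^sup>2"
  have \<delta>: "0 < \<delta>" using \<nu>\<kappa> by (simp add: \<delta>_def power_strict_mono)
  have \<Theta>U: "\<delta> \<le> \<Theta> y y" if "proj u {..<r} y = y" "norm y = 1" for y
  proof -
    have "s (r - 1) * norm (proj u {..<r} y) \<le> norm (sing_op s v u {..<r} y)"
      using r s_nonneg s_antimono by (intro norm_sing_op_ge on) auto
    also have "sing_op s v u {..<r} y = sing_op s v u {..<k} y"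
      using sing_op_proj[OF u order_refl Ik(1), of s v y] that(1) by (simp add: Ik)
    also have "norm \<dots> \<le> norm (T y) + e"
      using swap.norm_close[of y] that(2) by (simp add: T_def)
    finally have "\<kappa> \<le> norm (T y)" using that by (simp add: \<kappa>_def)
    then have "\<kappa>\<^sup>2 \<le> (norm (T y))\<^sup>2" using \<nu>\<kappa> by (intro power_mono) auto
    then show ?thesis using that(2)
      by (simp add: \<Theta>_def \<delta>_def power2_norm_eq_inner norm_eq_1)
  qed
  have \<Theta>V: "\<Theta> z z \<le> 0" if "proj u {..<r} z = 0" for z
  proof -
    have "inner (u l) z = 0" if "l < r" for l
      using inner_proj[OF u Ik(1), of l z] \<open>proj u {..<r} z = 0\<close> that r by simp
    then have "sing_op s v u {..<k} z = sing_op s v u {r..<k} z" by (rule sing_op_orthogonal)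
    then have "norm (T z) \<le> \<nu> * norm z"
      using dual.norm_close[of z] dual.norm_tail_le(2)[OF r(2), of z]
      by (simp add: T_def \<nu>_def algebra_simps)
    then have "(norm (T z))\<^sup>2 \<le> (\<nu> * norm z)\<^sup>2" by (intro power_mono) auto
    then show ?thesis by (simp add: \<Theta>_def power_mult_distrib power2_norm_eq_inner)
  qed
  define S where "S = {inner y (J y) | y. proj u {..<r} y = y \<and> norm y = 1}"
  have J1: "\<bar>inner y (J y)\<bar> \<le> (norm y)\<^sup>2" for y
    using Cauchy_Schwarz_ineq2[of y "J y"] by (simp add: normJ power2_eq_square)
  have "-1 \<le> inner y (J y)" if "norm y = 1" for y using J1[of y] that by simp
  then have S_ge: "-1 \<le> m" if "m \<in> S" for m using that by (auto simp: S_def)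
  define \<mu> where "\<mu> = Inf S"
  have bdd: "bdd_below S" using S_ge by (rule bdd_belowI)
  have x0: "x \<noteq> 0" using neg by (auto simp: proj_def)
  define x1 where "x1 = inverse (norm x) *\<^sub>R x"
  have x1: "proj u {..<r} x1 = x1" "norm x1 = 1" using x x0 by (simp_all add: x1_def proj_scaleR)
  have C0: "0 < C"
    using order_less_le_trans[OF \<delta> \<Theta>U[OF x1]] \<Theta>C[of x1 x1] x1(2) by simp
  from x1 have x1S: "inner x1 (J x1) \<in> S" unfolding S_def by blast
  have "inner x (J x) < 0"
    using neg unfolding xJx P_def by (simp add: not_le power_strict_mono)
  then have "inner x1 (J x1) < 0"
    using x0 by (simp add: x1_def Jlin mult_pos_neg)
  then have \<mu>0: "\<mu> < 0" using cInf_lower[OF x1S bdd] by (simp add: \<mu>_def)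
  have \<mu>1: "-1 \<le> \<mu>" unfolding \<mu>_def using x1S S_ge by (intro cInf_greatest) auto
  have q: "\<mu> * (norm b)\<^sup>2 \<le> inner b (J b)" if "proj u {..<r} b = b" for b
  proof (cases "b = 0")
    case False
    have "proj u {..<r} (inverse (norm b) *\<^sub>R b) = inverse (norm b) *\<^sub>R b"
      "norm (inverse (norm b) *\<^sub>R b) = 1" using that False by (simp_all add: proj_scaleR)
    then have "inner (inverse (norm b) *\<^sub>R b) (J (inverse (norm b) *\<^sub>R b)) \<in> S"
      unfolding S_def by blast
    then have "\<mu> \<le> inner (inverse (norm b) *\<^sub>R b) (J (inverse (norm b) *\<^sub>R b))"
      unfolding \<mu>_def using bdd by (rule cInf_lower)
    then show ?thesis using False
      by (simp add: Jlin field_simps power2_eq_square)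
  qed (simp add: J_def P_def proj_def)
  \<comment> \<open>The lower bound for ||w||: a - w is orthogonal to W, so \<open>\<delta>\<close>
    \<le> \<open>\<Theta> a a\<close> \<le> \<open>2 * \<Theta> a w - \<Theta> w w\<close> \<le> 6 C
    ||w||, since both a and w have norm at most 2.\<close>
  define \<eta> where "\<eta> = \<delta> / (6 * C)"
  have "\<mu> + \<eta>\<^sup>2 / 2 \<le> m" if m: "m \<in> S" for m
  proof -
    obtain y where y: "proj u {..<r} y = y" "norm y = 1" "m = inner y (J y)"
      using m by (auto simp: S_def)
    define a where "a = J y + (- \<mu>) *\<^sub>R y"
    define w where "w = proj u {..<r} a"
    have pw: "proj u {..<r} w = w" unfolding w_def by (rule proj_idem[OF on(1)]) simp
    have na: "norm a \<le> 2"
      unfolding a_def using norm_triangle_ineq[of "J y" "(- \<mu>) *\<^sub>R y"] \<mu>0 \<mu>1 y(2) normJ[of y] by simp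
    have nw: "norm w \<le> norm a" unfolding w_def by (intro norm_proj_le on) simp
    have aa: "\<Theta> a a = \<Theta> y y + 2 * (- \<mu>) * \<Theta> y (J y) + \<mu>\<^sup>2 * \<Theta> y y"
      unfolding a_def \<Theta>lin by (simp add: \<Theta>J) (simp add: \<Theta>_def inner_commute)
    have "0 \<le> (- \<mu>) * \<Theta> y (J y)" using \<mu>0 \<Theta>xJ by (intro mult_nonneg_nonneg) auto
    moreover have "0 \<le> \<mu>\<^sup>2 * \<Theta> y y" using \<Theta>U[OF y(1,2)] \<delta> by (intro mult_nonneg_nonneg) auto
    ultimately have "\<delta> \<le> \<Theta> a a" using \<Theta>U[OF y(1,2)] aa by linarith
    moreover have "\<Theta> a a - 2 * \<Theta> a w + \<Theta> w w \<le> 0"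
      using \<Theta>V[of "a + (-1) *\<^sub>R w"] pw unfolding \<Theta>lin proj_add proj_scaleR
      by (simp add: w_def)
    moreover have "\<bar>\<Theta> a w\<bar> \<le> C * (2 * norm w)" "\<bar>\<Theta> w w\<bar> \<le> C * (2 * norm w)"
      using na nw by (auto intro!: order_trans[OF \<Theta>C] mult_left_mono mult_right_mono simp: C_def)
    ultimately have "\<delta> \<le> 6 * (C * norm w)" by linarith
    then have "\<eta> \<le> norm w"
      unfolding \<eta>_def using C0 by (simp add: pos_divide_le_eq mult_ac)
    moreover have "0 \<le> \<eta>" using \<delta> C0 by (simp add: \<eta>_def)
    ultimately have \<eta>w: "\<eta>\<^sup>2 \<le> (norm w)\<^sup>2" by (intro power_mono)
    have wa: "inner w (J y) = (norm w)\<^sup>2 + \<mu> * inner w y"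
    proof -
      have "inner w a = (norm w)\<^sup>2"
        unfolding w_def power2_norm_eq_inner by (metis pw proj_self_adjoint w_def)
      then show ?thesis by (simp add: a_def inner_diff)
    qed
    \<comment> \<open>On W the form <b, J b> - \<open>\<mu>\<close> ||b||^2 is nonnegative and has
      gradient 2 w at y. Moving by -w/2 lowers it by ||w||^2 minus a quadratic term of at most
      ||w||^2 / 2, so it was at least ||w||^2 / 2 at y.\<close>
    have pb: "proj u {..<r} (y + (- 1/2) *\<^sub>R w) = y + (- 1/2) *\<^sub>R w"
      by (simp only: proj_add proj_scaleR pw y(1))
    have yJ: "inner y (J w) = inner w (J y)" by (metis JS inner_commute)
    have "\<mu> * (norm (y + (- 1/2) *\<^sub>R w))\<^sup>2 \<le> inner (y + (- 1/2) *\<^sub>R w) (J (y + (- 1/2) *\<^sub>R w))"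
      by (rule q[OF pb])
    also have "\<dots> = m - inner w (J y) + inner w (J w) / 4"
      by (simp only: Jlin inner_add inner_scaleR yJ y(3)) (simp add: field_simps)
    also have "(norm (y + (- 1/2) *\<^sub>R w))\<^sup>2 = 1 - inner w y + (norm w)\<^sup>2 / 4"
      using y(2) by (simp only: power2_norm_eq_inner inner_add inner_scaleR inner_commute[of y w] norm_eq_1)
        (simp add: field_simps)
    finally have "\<mu> + \<mu> * (norm w)\<^sup>2 / 4 \<le> m - (norm w)\<^sup>2 + inner w (J w) / 4"
      unfolding wa by (simp add: algebra_simps)
    moreover have "inner w (J w) \<le> (norm w)\<^sup>2" using J1[of w] by simp
    moreover have "- ((norm w)\<^sup>2) \<le> \<mu> * (norm w)\<^sup>2"
      using mult_right_mono[OF \<mu>1, of "(norm w)\<^sup>2"] by simp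
    ultimately show ?thesis using \<eta>w by linarith
  qed
  then have "\<mu> + \<eta>\<^sup>2 / 2 \<le> \<mu>"
    unfolding \<mu>_def using x1S by (intro cInf_greatest) auto
  moreover have "0 < \<eta>" using \<delta> C0 by (simp add: \<eta>_def)
  ultimately show False by simp
qed

end

section \<open>The spectral and Frobenius bounds for operators\<close>

text \<open>Each weight is at most g^2. Swapping the projections writes their total as a sum over
  only r vectors, again at most g^2 each, so the bathtub principle keeps r singular values from p
  on. For p = 0 and g = 1 it says that a projection of rank r retains no more than the r leading
  values.\<close>

lemma sum_sing_val_proj_le:
  assumes c: "orthonormal_on {..<r} c" and b: "orthonormal_on {p..<k} b"
    and s: "\<And>i. i < k \<Longrightarrow> 0 \<le> s i" "\<And>i j. i \<le> j \<Longrightarrow> j < k \<Longrightarrow> s j \<le> s i"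
    and g: "\<And>x. norm (proj c {..<r} (proj b {p..<k} x)) \<le> g * norm x" "0 \<le> g"
  shows "(\<Sum>i=p..<k. (s i)\<^sup>2 * (norm (proj c {..<r} (b i)))\<^sup>2) \<le> (g * L2_set s {p..<min (p + r) k})\<^sup>2"
proof -
  have "(\<Sum>i=p..<k. (s i)\<^sup>2 * (norm (proj c {..<r} (b i)))\<^sup>2)
      \<le> g\<^sup>2 * (\<Sum>i=p..<min (p + r) k. (s i)\<^sup>2)"
  proof (rule weighted_sum_le)
    fix i assume i: "p \<le> i" "i < k"
    then have "proj b {p..<k} (b i) = b i" and "norm (b i) = 1"
      using b by (auto simp: proj_def orthonormal_on_def if_distrib[of "\<lambda>x. x *\<^sub>R _"]
          norm_eq_sqrt_inner cong: if_cong)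
    then have "norm (proj c {..<r} (b i)) \<le> g" using g(1)[of "b i"] by simp
    then show "0 \<le> (norm (proj c {..<r} (b i)))\<^sup>2 \<and> (norm (proj c {..<r} (b i)))\<^sup>2 \<le> g\<^sup>2"
      by (simp add: power_mono)
  next
    have "(\<Sum>i=p..<k. (norm (proj c {..<r} (b i)))\<^sup>2) = (\<Sum>l<r. (norm (proj b {p..<k} (c l)))\<^sup>2)"
      by (rule sum_norm_proj_swap[OF b _ c]) auto
    also have "\<dots> \<le> (\<Sum>l<r. g\<^sup>2)"
    proof (intro sum_mono power_mono)
      fix l assume "l \<in> {..<r}"
      then have "proj c {..<r} (c l) = c l" and "norm (c l) = 1"
        using c by (auto simp: proj_def orthonormal_on_def if_distrib[of "\<lambda>x. x *\<^sub>R _"]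
            norm_eq_sqrt_inner cong: if_cong)
      then show "norm (proj b {p..<k} (c l)) \<le> g"
        using norm_proj_proj_swap[OF b _ c _ g(1), of "c l"] by simp
    qed simp
    finally show "(\<Sum>i=p..<k. (norm (proj c {..<r} (b i)))\<^sup>2) \<le> g\<^sup>2 * real r" by (simp add: mult.commute)
  qed (use s in \<open>auto intro!: power_mono\<close>)
  then show ?thesis by (simp add: L2_set_def power_mult_distrib sum_nonneg)
qed

lemma L2_set_le_iff_sum: "0 \<le> c \<Longrightarrow> L2_set f A \<le> c \<longleftrightarrow> (\<Sum>i\<in>A. (f i)\<^sup>2) \<le> c\<^sup>2"
  using real_sqrt_le_iff[of "\<Sum>i\<in>A. (f i)\<^sup>2" "c\<^sup>2"] by (simp add: L2_set_def)

context sing_pair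
begin

lemma spectral_bound:
  assumes r: "1 \<le> r" "r < k"
    and g: "g = (if 2 * e < s (r - 1) - s r then 2 * e / (s (r - 1) - s r) else 1)"
  shows "norm (sing_op s u v {..<r} x - sing_op s' u' v' {..<r} x) \<le> (2 * e + 2 * s r * g) * norm x"
proof (cases "2 * e < s (r - 1) - s r")
  case False
  interpret swap: sing_pair s' u' v' s u v k e
    by (rule sing_pair_swap) unfold_locales
  have g1: "g = 1" using False g by simp
  have eq: "sing_op s u v {..<r} x - sing_op s' u' v' {..<r} x
    = (sing_op s' u' v' {r..<k} x - sing_op s u v {r..<k} x)
      - (sing_op s' u' v' {..<k} x - sing_op s u v {..<k} x)"
    using r by (simp add: sing_op_split[of r k])
  have "norm (sing_op s' u' v' {r..<k} x) \<le> (s r + e) * norm x"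
    using swap.norm_tail_le(2)[OF r(2), of x] mult_right_mono[OF weyl[OF r(2)], of "norm x"] by simp
  then have "norm (sing_op s' u' v' {r..<k} x - sing_op s u v {r..<k} x)
    \<le> (s r + e) * norm x + s r * norm x"
    using norm_tail_le(2)[OF r(2), of x] norm_triangle_ineq4[of "sing_op s' u' v' {r..<k} x"]
    by (smt (verit, best))
  then show ?thesis unfolding eq g1
    using norm_triangle_ineq4[of "sing_op s' u' v' {r..<k} x - sing_op s u v {r..<k} x"
        "sing_op s' u' v' {..<k} x - sing_op s u v {..<k} x"] close[of x]
    by (simp add: algebra_simps)
next
  case True
  interpret dual: sing_pair s v u s' v' u' k e
    by (rule sing_pair_dual) unfold_locales
  have Ik: "{..<r} \<subseteq> {..<k}" "{r..<k} \<subseteq> {..<k}" "{..<k} \<inter> {..<r} = {..<r}"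
    "{..<r} \<inter> {..<k} = {..<r}" using r by auto
  note on = orthonormal_sub[OF Ik(1)] orthonormal_sub[OF Ik(2)]
  define P where "P = proj u' {..<r}"
  define Q where "Q = proj v' {..<r}"
  define D where "D z = sing_op s' u' v' {..<k} z - sing_op s u v {..<k} z" for z
  define X where "X z = sing_op s u v {..<r} z - sing_op s' u' v' {..<r} z" for z
  define c where "c = e + s r * g"
  have g0: "0 \<le> g" using g e_nonneg True by simp
  have c0: "0 \<le> c" using g0 e_nonneg s_nonneg[OF r(2)] by (simp add: c_def)
  have D: "norm (D z) \<le> e * norm z" for z unfolding D_def by (rule close)
  have Xz: "X z = sing_op s' u' v' {..<k} z - sing_op s' u' v' {..<r} z - (sing_op s u v {r..<k} z + D z)" for z
    using r by (simp add: X_def D_def sing_op_split[of r k s u v])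
  have PX: "norm (P (X z)) \<le> c * norm z" for z
  proof -
    have "P (X z) = - (P (sing_op s u v {r..<k} z) + P (D z))"
      unfolding Xz P_def proj_diff proj_add
      by (simp add: proj_sing_op[OF u' Ik(1)] proj_sing_op[OF u' Ik(1,1)] Ik)
    moreover have "norm (P (D z)) \<le> e * norm z"
      using D[of z] norm_proj_le(1)[OF on(3), of "D z"] unfolding P_def by simp
    moreover have "norm (P (sing_op s u v {r..<k} z)) \<le> (s r * g) * norm z"
    proof -
      have "sing_op s u v {r..<k} z = proj u {r..<k} (sing_op s u v {r..<k} z)"
        by (simp add: proj_sing_op[OF u Ik(2,2)])
      then have "norm (P (sing_op s u v {r..<k} z)) \<le> g * norm (sing_op s u v {r..<k} z)"
        unfolding P_def by (metis sin_theta(1)[OF r g])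
      also have "\<dots> \<le> g * (s r * norm z)"
        using g0 norm_tail_le(2)[OF r(2), of z] by (intro mult_left_mono)
      finally show ?thesis by (simp add: mult_ac)
    qed
    ultimately show ?thesis
      using norm_triangle_ineq[of "P (sing_op s u v {r..<k} z)" "P (D z)"]
      unfolding c_def distrib_right by (simp only: norm_minus_cancel)
  qed
  have QQ: "Q (Q z) = Q z" for z unfolding Q_def by (rule proj_idem[OF on(4)]) simp
  have XQ: "norm (X (Q z)) \<le> c * norm (Q z)" for z
  proof -
    have "sing_op s' u' v' {..<k} (Q z) = sing_op s' u' v' {..<r} (Q z)"
      unfolding Q_def by (simp add: sing_op_proj[OF v' _ Ik(1)] sing_op_proj[OF v' Ik(1,1)] Ik)
    then have eq: "X (Q z) = - (sing_op s u v {r..<k} (Q z) + D (Q z))" by (simp add: Xz)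
    have "norm (sing_op s u v {r..<k} (Q z)) \<le> s r * norm (proj v {r..<k} (Q z))"
      by (rule norm_tail_le(1)[OF r(2)])
    also have "norm (proj v {r..<k} (Q z)) \<le> g * norm (Q z)"
      using norm_proj_proj_swap[OF on(6) _ on(4) _ dual.sin_theta(1)[OF r g], of "Q z"] QQ[of z]
      by (simp add: Q_def)
    finally have "norm (sing_op s u v {r..<k} (Q z)) \<le> s r * (g * norm (Q z))"
      using s_nonneg[OF r(2)] by (simp add: mult_left_mono)
    then show ?thesis unfolding eq norm_minus_cancel
      using norm_triangle_ineq[of "sing_op s u v {r..<k} (Q z)" "D (Q z)"] D[of "Q z"]
      by (simp add: c_def algebra_simps)
  qed
  have Xlin: "X (a + b) = X a + X b" for a b by (simp add: X_def sing_op_add)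
  have XQ': "norm (X (x - Q x) - P (X (x - Q x))) \<le> c * norm (x - Q x)"
  proof -
    have "sing_op s' u' v' {..<r} (x - Q x) = 0"
      unfolding sing_op_diff Q_def by (simp add: sing_op_proj[OF v' Ik(1,1)])
    then have "X (x - Q x) = sing_op s u v {..<r} (x - Q x)" by (simp add: X_def)
    then have "proj u {..<r} (X (x - Q x)) = X (x - Q x)"
      by (simp add: proj_sing_op[OF u Ik(1,1)])
    from acute[OF r True this] PX[of "x - Q x"] show ?thesis unfolding P_def by simp
  qed
  have "X x - P (X x) = (X (Q x) - P (X (Q x))) + (X (x - Q x) - P (X (x - Q x)))"
    using Xlin[of "Q x" "x - Q x"] by (simp add: P_def proj_add)
  then have "norm (X x - P (X x)) \<le> norm (X (Q x)) + norm (X (x - Q x) - P (X (x - Q x)))"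
    using norm_triangle_mono[OF norm_proj_le(2)[OF on(3), of "X (Q x)"] order_refl]
    unfolding P_def by simp
  also have "\<dots> \<le> c * (norm (Q x) + norm (x - Q x))"
    using XQ[of x] XQ' by (simp add: algebra_simps)
  finally have "(norm (X x - P (X x)))\<^sup>2 \<le> c\<^sup>2 * (norm (Q x) + norm (x - Q x))\<^sup>2"
    by (metis norm_ge_zero power_mono power_mult_distrib)
  also have "(norm (Q x) + norm (x - Q x))\<^sup>2 \<le> 2 * (norm x)\<^sup>2"
    using pythagoras_proj[OF on(4), of x] sum_squares_bound[of "norm (Q x)" "norm (x - Q x)"]
    by (simp add: Q_def power2_sum)
  finally have "(norm (X x - P (X x)))\<^sup>2 \<le> c\<^sup>2 * (2 * (norm x)\<^sup>2)" by (simp add: mult_left_mono)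
  moreover have "(norm (P (X x)))\<^sup>2 \<le> c\<^sup>2 * (norm x)\<^sup>2"
    by (metis PX norm_ge_zero power_mono power_mult_distrib)
  moreover have "(norm (X x))\<^sup>2 = (norm (P (X x)))\<^sup>2 + (norm (X x - P (X x)))\<^sup>2"
    unfolding P_def by (rule pythagoras_proj[OF on(3)]) simp
  moreover have "0 \<le> c\<^sup>2 * (norm x)\<^sup>2" by simp
  \<comment> \<open>The two parts contribute c^2 and 2 c^2; the factor 3 is rounded up to 4 to reach
    the constant 2 c.\<close>
  ultimately have "(norm (X x))\<^sup>2 \<le> 4 * (c\<^sup>2 * (norm x)\<^sup>2)" by linarith
  then have "(norm (X x))\<^sup>2 \<le> (2 * c * norm x)\<^sup>2" by (simp add: power_mult_distrib)
  then have "norm (X x) \<le> 2 * c * norm x"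
    by (rule power2_le_imp_le) (use c0 in simp)
  then show ?thesis by (simp add: X_def c_def mult.assoc)
qed

lemma frobenius_bound:
  assumes r: "1 \<le> r" "r < k"
    and g: "g = (if 2 * e < s (r - 1) - s r then 2 * e / (s (r - 1) - s r) else 1)"
    and t: "orthonormal_on {..<k} w" "orthonormal_on {..<k} y"
      "\<And>i. i < k \<Longrightarrow> 0 \<le> t i" "\<And>i j. i \<le> j \<Longrightarrow> j < k \<Longrightarrow> t j \<le> t i"
    and eq: "\<And>x. sing_op s' u' v' {..<k} x = sing_op s u v {..<k} x + sing_op t w y {..<k} x"
    and f: "orthonormal_on J f" "finite J"
  shows "(\<Sum>j\<in>J. (norm (sing_op s u v {..<r} (f j) - sing_op s' u' v' {..<r} (f j)))\<^sup>2)
    \<le> 2 * (L2_set t {..<r})\<^sup>2 + 3 * (L2_set t {..<r} + L2_set s {r..<min (r + r) k} * g)\<^sup>2"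
proof -
  interpret swap: sing_pair s' u' v' s u v k e
    by (rule sing_pair_swap) unfold_locales
  interpret dual: sing_pair s v u s' v' u' k e
    by (rule sing_pair_dual) unfold_locales
  have Ik: "{..<r} \<subseteq> {..<k}" "{r..<k} \<subseteq> {..<k}" "{..<k} \<inter> {..<r} = {..<r}"
    "{..<r} \<inter> {..<k} = {..<r}" using r by auto
  note on = orthonormal_sub[OF Ik(1)] orthonormal_sub[OF Ik(2)]
  define P where "P = proj u' {..<r}"
  \<comment> \<open>This is Q_0 of the overview, taken from the unperturbed matrix; in
    \<open>spectral_bound\<close> the letter \<open>Q\<close> belongs to the perturbed one.\<close>
  define Q where "Q = proj v {..<r}"
  define E where "E = sing_op t w y {..<k}"
  define X where "X z = sing_op s u v {..<r} z - sing_op s' u' v' {..<r} z" for z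
  define a where "a = L2_set t {..<r}"
  define b where "b = L2_set s {r..<min (r + r) k}"
  have g0: "0 \<le> g" "g \<le> 1" using g e_nonneg by (auto simp: divide_le_eq)
  have ab: "0 \<le> a" "0 \<le> b" by (simp_all add: a_def b_def)
  have t0: "orthonormal_on {0..<k} w" "orthonormal_on {0..<k} y"
    using t by (simp_all add: atLeast0LessThan)
  have mr: "{0..<min (0 + r) k} = {..<r}" using r by auto
  have PE: "L2_set (\<lambda>j. norm (P (E (f j)))) J \<le> a"
  proof -
    have "(\<Sum>j\<in>J. (norm (P (E (f j))))\<^sup>2) \<le> (\<Sum>i=0..<k. (t i)\<^sup>2 * (norm (P (w i)))\<^sup>2)"
      unfolding P_def E_def atLeast0LessThan
      by (rule sum_norm_proj_sing_op_le[OF t(2) _ f on(3)]) auto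
    also have "\<dots> \<le> (1 * L2_set t {0..<min (0 + r) k})\<^sup>2"
      unfolding P_def
      by (rule sum_sing_val_proj_le[OF on(3) t0(1) t(3,4)]) (auto intro!: norm_proj_proj_le on t0)
    finally show ?thesis using ab by (simp add: L2_set_le_iff_sum a_def mr[simplified])
  qed
  have PA: "L2_set (\<lambda>j. norm (P (sing_op s u v {r..<k} (f j)))) J \<le> g * b"
  proof -
    have "(\<Sum>j\<in>J. (norm (P (sing_op s u v {r..<k} (f j))))\<^sup>2) \<le> (\<Sum>i=r..<k. (s i)\<^sup>2 * (norm (P (u i)))\<^sup>2)"
      unfolding P_def
      by (rule sum_norm_proj_sing_op_le[OF on(6) _ f on(3)]) auto
    also have "\<dots> \<le> (g * b)\<^sup>2"
      unfolding P_def b_def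
      by (rule sum_sing_val_proj_le[OF on(3,5) s_nonneg s_antimono sin_theta(1)[OF r g] g0(1)])
    finally show ?thesis using ab g0 by (simp add: L2_set_le_iff_sum)
  qed
  have QS: "inner (Q x) z = inner x (Q z)" for x z unfolding Q_def by (rule proj_self_adjoint)
  have EQ: "L2_set (\<lambda>j. norm (E (Q (f j)))) J \<le> a"
  proof -
    have "(\<Sum>j\<in>J. (norm (E (Q (f j))))\<^sup>2) \<le> (\<Sum>i=0..<k. (t i)\<^sup>2 * (norm (Q (y i)))\<^sup>2)"
      unfolding E_def atLeast0LessThan
      by (rule sum_norm_sing_op_le[OF t(1) _ f QS]) auto
    also have "\<dots> \<le> (1 * L2_set t {0..<min (0 + r) k})\<^sup>2"
      unfolding Q_def
      by (rule sum_sing_val_proj_le[OF on(2) t0(2) t(3,4)]) (auto intro!: norm_proj_proj_le on t0)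
    finally show ?thesis using ab by (simp add: L2_set_le_iff_sum a_def mr[simplified])
  qed
  have AQ: "L2_set (\<lambda>j. norm (sing_op s' u' v' {r..<k} (Q (f j)))) J \<le> g * (b + a)"
  proof -
    have "(\<Sum>j\<in>J. (norm (sing_op s' u' v' {r..<k} (Q (f j))))\<^sup>2)
        \<le> (\<Sum>i=r..<k. (s' i)\<^sup>2 * (norm (Q (v' i)))\<^sup>2)"
      by (rule sum_norm_sing_op_le[OF on(7) _ f QS]) auto
    also have "\<dots> \<le> (g * L2_set s' {r..<min (r + r) k})\<^sup>2"
      unfolding Q_def
      by (rule sum_sing_val_proj_le[OF on(2,8) s'_nonneg s'_antimono dual.sin_theta(2)[OF r g] g0(1)])
    also have "\<dots> \<le> (g * (b + a))\<^sup>2"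
      unfolding a_def b_def using g0 r
      by (intro power_mono mult_left_mono tail_sum_le[OF t eq]) auto
    finally show ?thesis using ab g0 by (simp add: L2_set_le_iff_sum)
  qed
  have PX: "P (X z) = - (P (sing_op s u v {r..<k} z) + P (E z))" for z
  proof -
    have "X z = (sing_op s' u' v' {..<k} z - sing_op s' u' v' {..<r} z) - (sing_op s u v {r..<k} z + E z)"
      using r by (simp add: X_def E_def eq sing_op_split[of r k s u v])
    then show ?thesis
      unfolding P_def proj_diff proj_add
      by (simp add: proj_diff proj_add proj_sing_op[OF u' Ik(1)] proj_sing_op[OF u' Ik(1,1)] Ik)
  qed
  have "L2_set (\<lambda>j. norm (P (X (f j)))) J
      \<le> L2_set (\<lambda>j. norm (P (sing_op s u v {r..<k} (f j))) + norm (P (E (f j)))) J"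
    unfolding PX by (intro L2_set_mono) (auto intro: norm_triangle_ineq simp del: minus_add_distrib)
  also have "\<dots> \<le> g * b + a"
    by (rule order_trans[OF L2_set_triangle_ineq add_mono[OF PA PE]])
  finally have 1: "(\<Sum>j\<in>J. (norm (P (X (f j))))\<^sup>2) \<le> (a + b * g)\<^sup>2"
    using ab g0 by (simp add: L2_set_le_iff_sum add.commute mult.commute)
  have X2: "X z - P (X z) = sing_op s' u' v' {r..<k} (Q z) - (E (Q z) - P (E (Q z)))" for z
  proof -
    have PB: "P (sing_op s' u' v' {..<r} z) = sing_op s' u' v' {..<r} z"
      "P (sing_op s' u' v' {..<k} (Q z)) = sing_op s' u' v' {..<r} (Q z)"
      unfolding P_def by (simp_all add: proj_sing_op[OF u' Ik(1)] proj_sing_op[OF u' Ik(1,1)] Ik)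
    have "sing_op s u v {..<r} z = sing_op s u v {..<k} (Q z)"
      unfolding Q_def by (simp add: sing_op_proj[OF v _ Ik(1)] Ik)
    then have B: "sing_op s u v {..<r} z = sing_op s' u' v' {..<k} (Q z) - E (Q z)"
      by (simp add: eq E_def)
    show ?thesis
      unfolding X_def B using PB r unfolding P_def
      by (simp add: proj_diff sing_op_split[of r k s' u' v' "Q z"])
  qed
  have "L2_set (\<lambda>j. norm (X (f j) - P (X (f j)))) J
      \<le> L2_set (\<lambda>j. norm (sing_op s' u' v' {r..<k} (Q (f j))) + norm (E (Q (f j)))) J"
  proof (rule L2_set_mono)
    show "norm (X (f j) - P (X (f j))) \<le> norm (sing_op s' u' v' {r..<k} (Q (f j))) + norm (E (Q (f j)))" for j
      unfolding X2
      using norm_triangle_ineq4[of "sing_op s' u' v' {r..<k} (Q (f j))" "E (Q (f j)) - P (E (Q (f j)))"]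
        norm_proj_le(2)[OF on(3), of "E (Q (f j))"] by (simp add: P_def)
  qed simp
  also have "\<dots> \<le> g * (b + a) + a"
    by (rule order_trans[OF L2_set_triangle_ineq add_mono[OF AQ EQ]])
  \<comment> \<open>The term g a, which stems from comparing the tails of s' and s, is absorbed by g
    \<le> 1.\<close>
  also have "\<dots> \<le> a + (a + b * g)"
    using mult_right_mono[OF g0(2) ab(1)] by (simp add: algebra_simps)
  finally have 2: "(\<Sum>j\<in>J. (norm (X (f j) - P (X (f j))))\<^sup>2) \<le> (a + (a + b * g))\<^sup>2"
    using ab g0 by (simp add: L2_set_le_iff_sum)
  have "(\<Sum>j\<in>J. (norm (X (f j)))\<^sup>2)
      = (\<Sum>j\<in>J. (norm (P (X (f j))))\<^sup>2 + (norm (X (f j) - P (X (f j))))\<^sup>2)"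
    unfolding P_def by (intro sum.cong refl pythagoras_proj[OF on(3)]) simp
  also have "\<dots> \<le> (a + b * g)\<^sup>2 + (a + (a + b * g))\<^sup>2"
    unfolding sum.distrib using 1 2 by (rule add_mono)
  \<comment> \<open>Origin of the constants 2 and 3: with c = a + b g the left side is a^2 + 2 a c +
    2 c^2, and 2 a c \<le> a^2 + c^2.\<close>
  also have "\<dots> \<le> 2 * a\<^sup>2 + 3 * (a + b * g)\<^sup>2"
    using sum_squares_bound[of a "a + b * g"] by (simp add: power2_sum)
  finally show ?thesis by (simp add: X_def a_def b_def)
qed

end
section \<open>Finitely supported sequences\<close>

text \<open>Vectors of all dimensions are embedded into this one inner product space, since the
  dimensions of a JNF matrix are terms and not types.\<close>

typedef fin_seq = "{f :: nat \<Rightarrow> real. finite {i. f i \<noteq> 0}}"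
  morphisms coord Abs_fin_seq
  by (rule exI[of _ "\<lambda>_. 0"]) simp

setup_lifting type_definition_fin_seq

lemma fin_seq_eqI: "(\<And>i. coord x i = coord y i) \<Longrightarrow> x = y"
  by (simp add: coord_inject[symmetric] ext)

lemma finite_coord: "finite {i. coord x i \<noteq> 0}"
  using coord[of x] by simp

instantiation fin_seq :: real_vector
begin

lift_definition zero_fin_seq :: fin_seq is "\<lambda>_. 0" by simp

lift_definition plus_fin_seq :: "fin_seq \<Rightarrow> fin_seq \<Rightarrow> fin_seq" is "\<lambda>f g i. f i + g i"
proof -
  fix f g :: "nat \<Rightarrow> real"
  assume "finite {i. f i \<noteq> 0}" "finite {i. g i \<noteq> 0}"
  then show "finite {i. f i + g i \<noteq> 0}"
    by (rule finite_subset[rotated, OF finite_UnI]) auto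
qed

lift_definition minus_fin_seq :: "fin_seq \<Rightarrow> fin_seq \<Rightarrow> fin_seq" is "\<lambda>f g i. f i - g i"
proof -
  fix f g :: "nat \<Rightarrow> real"
  assume "finite {i. f i \<noteq> 0}" "finite {i. g i \<noteq> 0}"
  then show "finite {i. f i - g i \<noteq> 0}"
    by (rule finite_subset[rotated, OF finite_UnI]) auto
qed

lift_definition uminus_fin_seq :: "fin_seq \<Rightarrow> fin_seq" is "\<lambda>f i. - f i" by simp

lift_definition scaleR_fin_seq :: "real \<Rightarrow> fin_seq \<Rightarrow> fin_seq" is "\<lambda>c f i. c * f i"
  by (rule finite_subset[rotated]) auto

lemmas coord_simps =
  zero_fin_seq.rep_eq plus_fin_seq.rep_eq minus_fin_seq.rep_eq uminus_fin_seq.rep_eq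
  scaleR_fin_seq.rep_eq

instance
  by standard (auto intro!: fin_seq_eqI simp: coord_simps algebra_simps)

end

instantiation fin_seq :: real_inner
begin

definition inner_fin_seq :: "fin_seq \<Rightarrow> fin_seq \<Rightarrow> real" where
  "inner_fin_seq x y = (\<Sum>i\<in>{i. coord x i \<noteq> 0}. coord x i * coord y i)"

definition norm_fin_seq :: "fin_seq \<Rightarrow> real" where
  "norm_fin_seq x = sqrt (inner x x)"

definition sgn_fin_seq :: "fin_seq \<Rightarrow> fin_seq" where
  "sgn_fin_seq x = x /\<^sub>R norm x"

definition dist_fin_seq :: "fin_seq \<Rightarrow> fin_seq \<Rightarrow> real" where
  "dist_fin_seq x y = norm (x - y)"

definition uniformity_fin_seq :: "(fin_seq \<times> fin_seq) filter" where
  "uniformity_fin_seq = (INF e\<in>{0<..}. principal {(x, y). dist x y < e})"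

definition open_fin_seq :: "fin_seq set \<Rightarrow> bool" where
  "open_fin_seq U \<longleftrightarrow> (\<forall>x\<in>U. eventually (\<lambda>(x', y). x' = x \<longrightarrow> y \<in> U) uniformity)"

text \<open>Enlarging the support to any finite set lets symmetry and additivity be checked on one
  common index set.\<close>

lemma inner_fin_seq_eq:
  assumes "finite S" "\<And>i. i \<notin> S \<Longrightarrow> coord x i = 0"
  shows "inner x y = (\<Sum>i\<in>S. coord x i * coord y i)"
  unfolding inner_fin_seq_def using assms
  by (intro sum.mono_neutral_left) auto

instance
proof
  fix x y z :: fin_seq and a :: real
  show "sgn x = x /\<^sub>R norm x" by (rule sgn_fin_seq_def)
  show "dist x y = norm (x - y)" by (rule dist_fin_seq_def)
  show "uniformity = (INF e\<in>{0<..}. principal {(x :: fin_seq, y). dist x y < e})"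
    by (rule uniformity_fin_seq_def)
  show "open U \<longleftrightarrow> (\<forall>x\<in>U. eventually (\<lambda>(x', y). x' = x \<longrightarrow> y \<in> U) uniformity)"
    for U :: "fin_seq set" by (rule open_fin_seq_def)
  define S where "S = {i. coord x i \<noteq> 0} \<union> {i. coord y i \<noteq> 0}"
  have S: "finite S" "\<And>i. i \<notin> S \<Longrightarrow> coord x i = 0" "\<And>i. i \<notin> S \<Longrightarrow> coord y i = 0"
    using finite_coord by (auto simp: S_def)
  show "inner x y = inner y x"
    by (simp add: inner_fin_seq_eq[OF S(1,2)] inner_fin_seq_eq[OF S(1,3)] mult.commute)
  have "\<And>i. i \<notin> S \<Longrightarrow> coord (x + y) i = 0" using S by (simp add: coord_simps)
  then show "inner (x + y) z = inner x z + inner y z"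
    by (simp add: inner_fin_seq_eq[OF S(1)] S(2,3) coord_simps sum.distrib distrib_right)
  have "\<And>i. i \<notin> S \<Longrightarrow> coord (a *\<^sub>R x) i = 0" using S by (simp add: coord_simps)
  then show "inner (a *\<^sub>R x) y = a * inner x y"
    by (simp add: inner_fin_seq_eq[OF S(1)] S(2) coord_simps sum_distrib_left mult.assoc)
  show "0 \<le> inner x x" by (simp add: inner_fin_seq_def sum_nonneg)
  show "inner x x = 0 \<longleftrightarrow> x = 0"
  proof
    assume "inner x x = 0"
    then have "\<forall>i\<in>{i. coord x i \<noteq> 0}. coord x i * coord x i = 0"
      unfolding inner_fin_seq_def using finite_coord[of x]
      by (subst (asm) sum_nonneg_eq_0_iff) auto
    then show "x = 0" by (intro fin_seq_eqI) (auto simp: coord_simps)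
  qed (simp add: inner_fin_seq_def coord_simps)
  show "norm x = sqrt (inner x x)" by (rule norm_fin_seq_def)
qed

end

lemma coord_sum: "coord (\<Sum>l\<in>I. f l) i = (\<Sum>l\<in>I. coord (f l) i)"
  by (induction I rule: infinite_finite_induct) (simp_all add: coord_simps)

definition embed_vec :: "real vec \<Rightarrow> fin_seq" where
  "embed_vec v = Abs_fin_seq (\<lambda>i. if i < dim_vec v then v $ i else 0)"

lemma coord_embed_vec: "coord (embed_vec v) i = (if i < dim_vec v then v $ i else 0)"
  unfolding embed_vec_def
  by (subst Abs_fin_seq_inverse) (auto intro: finite_subset[of _ "{..<dim_vec v}"])

lemma inner_embed_vec: "inner (embed_vec v) x = (\<Sum>i<dim_vec v. v $ i * coord x i)"
  by (subst inner_fin_seq_eq[of "{..<dim_vec v}"]) (auto simp: coord_embed_vec)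

lemma norm_embed_vec: "norm (embed_vec v) = vnorm v"
  unfolding norm_eq_sqrt_inner inner_embed_vec vnorm_def
  by (simp add: coord_embed_vec power2_eq_square)

section \<open>From matrices to operators\<close>

text \<open>Output coordinates beyond the rows are zero and input coordinates beyond the columns are
  ignored. This fixes \<open>T\<close> on the whole sequence space, so identities of matrices become
  identities of operators.\<close>

definition represents :: "real mat \<Rightarrow> (fin_seq \<Rightarrow> fin_seq) \<Rightarrow> bool" where
  "represents M T \<longleftrightarrow> (\<forall>x i. coord (T x) i =
     (if i < dim_row M then \<Sum>j<dim_col M. M $$ (i,j) * coord x j else 0))"

lemma represents_unique: "represents M T \<Longrightarrow> represents M T' \<Longrightarrow> T x = T' x"
  by (rule fin_seq_eqI) (simp add: represents_def)

lemma represents_add: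
  assumes "A \<in> carrier_mat n m" "B \<in> carrier_mat n m" "represents A T" "represents B T'"
  shows "represents (A + B) (\<lambda>x. T x + T' x)"
  using assms by (auto simp: represents_def coord_simps sum.distrib distrib_right)

lemma represents_diff:
  assumes "A \<in> carrier_mat n m" "B \<in> carrier_mat n m" "represents A T" "represents B T'"
  shows "represents (A - B) (\<lambda>x. T x - T' x)"
  using assms by (auto simp: represents_def coord_simps sum_subtractf left_diff_distrib)

lemma represents_mult_vec:
  assumes "represents M T" "y \<in> carrier_vec (dim_col M)"
  shows "T (embed_vec y) = embed_vec (M *\<^sub>v y)"
  using assms
  by (intro fin_seq_eqI)
    (auto simp: represents_def coord_embed_vec scalar_prod_def atLeast0LessThan intro!: sum.cong)

lemma frob_norm_represents:
  assumes "represents M T"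
  shows "frob_norm M = L2_set (\<lambda>j. norm (T (embed_vec (unit_vec (dim_col M) j)))) {..<dim_col M}"
proof -
  have "(norm (T (embed_vec (unit_vec (dim_col M) j))))\<^sup>2 = (\<Sum>i<dim_row M. (M $$ (i,j))\<^sup>2)"
    if "j < dim_col M" for j
  proof -
    have "M *\<^sub>v unit_vec (dim_col M) j = col M j"
      using that by (intro eq_vecI) auto
    then have "T (embed_vec (unit_vec (dim_col M) j)) = embed_vec (col M j)"
      using represents_mult_vec[OF assms, of "unit_vec (dim_col M) j"] by simp
    then show ?thesis
      by (simp add: norm_embed_vec vnorm_def sum_nonneg that)
  qed
  then show ?thesis unfolding frob_norm_def L2_set_def
    by (subst sum.swap) simp
qed

lemma spec_norm_le:
  assumes T: "represents M T" and "\<And>x. norm (T x) \<le> c * norm x" and "0 < dim_col M"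
  shows "spec_norm M \<le> c"
  unfolding spec_norm_def
proof (rule cSup_least)
  have "vnorm (unit_vec (dim_col M) 0) = 1"
    using assms(3) by (simp add: vnorm_def power2_eq_square if_distrib[of "\<lambda>x. x * _"] sum.delta cong: if_cong)
  then show "{vnorm (M *\<^sub>v x) |x. x \<in> carrier_vec (dim_col M) \<and> vnorm x = 1} \<noteq> {}"
    by (auto intro!: exI[of _ "unit_vec (dim_col M) 0"])
next
  fix a assume "a \<in> {vnorm (M *\<^sub>v x) |x. x \<in> carrier_vec (dim_col M) \<and> vnorm x = 1}"
  then obtain x where "x \<in> carrier_vec (dim_col M)" "vnorm x = 1" "a = vnorm (M *\<^sub>v x)" by blast
  then show "a \<le> c"
    using assms(2)[of "embed_vec x"] by (simp add: represents_mult_vec[OF T] norm_embed_vec)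
qed

text \<open>The constant \<open>c\<close> serves only to bound the set from above, so that its
  supremum is meaningful.\<close>

lemma norm_le_spec_norm:
  assumes T: "represents M T" and "\<And>x. norm (T x) \<le> c * norm x"
    and "y \<in> carrier_vec (dim_col M)" "vnorm y = 1"
  shows "norm (T (embed_vec y)) \<le> spec_norm M"
  unfolding spec_norm_def represents_mult_vec[OF T assms(3)] norm_embed_vec
proof (rule cSup_upper)
  show "bdd_above {vnorm (M *\<^sub>v x) |x. x \<in> carrier_vec (dim_col M) \<and> vnorm x = 1}"
  proof (rule bdd_aboveI)
    fix a assume "a \<in> {vnorm (M *\<^sub>v x) |x. x \<in> carrier_vec (dim_col M) \<and> vnorm x = 1}"
    then obtain x where "x \<in> carrier_vec (dim_col M)" "vnorm x = 1" "a = vnorm (M *\<^sub>v x)" by blast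
    then show "a \<le> c"
      using assms(2)[of "embed_vec x"] by (simp add: represents_mult_vec[OF T] norm_embed_vec)
  qed
qed (use assms in auto)

lemma orthonormal_embed_cols:
  assumes "orth_mat n U"
  shows "orthonormal_on {..<n} (\<lambda>l. embed_vec (col U l))"
  unfolding orthonormal_on_def
proof (intro ballI)
  fix i j assume ij: "i \<in> {..<n}" "j \<in> {..<n}"
  have U: "U \<in> carrier_mat n n" "transpose_mat U * U = 1\<^sub>m n" using assms by (auto simp: orth_mat_def)
  have "inner (embed_vec (col U i)) (embed_vec (col U j)) = (transpose_mat U * U) $$ (i,j)"
    using U(1) ij by (simp add: inner_embed_vec coord_embed_vec scalar_prod_def atLeast0LessThan)
  then show "inner (embed_vec (col U i)) (embed_vec (col U j)) = (if i = j then 1 else 0)"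
    using U(2) ij by simp
qed

lemma svd_trunc_carrier:
  assumes "is_svd A U S V" "A \<in> carrier_mat n m"
  shows "U * trunc_diag r S * transpose_mat V \<in> carrier_mat n m"
proof -
  have "U \<in> carrier_mat n n" "V \<in> carrier_mat m m" "S \<in> carrier_mat n m"
    using assms by (auto simp: is_svd_def orth_mat_def)
  then show ?thesis unfolding carrier_mat_def by simp
qed

lemma svd_represents:
  assumes svd: "is_svd A U S V" and A: "A \<in> carrier_mat n m" and r: "r \<le> min n m"
  shows "represents (U * trunc_diag r S * transpose_mat V)
    (sing_op (\<lambda>l. S $$ (l,l)) (\<lambda>l. embed_vec (col U l)) (\<lambda>l. embed_vec (col V l)) {..<r})"
proof -
  have U: "U \<in> carrier_mat n n" and V: "V \<in> carrier_mat m m" and S: "S \<in> carrier_mat n m"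
    using svd A by (auto simp: is_svd_def orth_mat_def)
  have D: "trunc_diag r S \<in> carrier_mat n m" using S by (simp add: trunc_diag_def)
  have UD: "(U * trunc_diag r S) $$ (i,l) = (if l < r then U $$ (i,l) * S $$ (l,l) else 0)"
    if "i < n" "l < m" for i l
  proof -
    have "(U * trunc_diag r S) $$ (i,l)
        = (\<Sum>p<n. if p = l then (if l < r then U $$ (i,l) * S $$ (l,l) else 0) else 0)"
    proof -
      have "(U * trunc_diag r S) $$ (i,l) = (\<Sum>p<n. U $$ (i,p) * trunc_diag r S $$ (p,l))"
        using that U D by (simp add: scalar_prod_def atLeast0LessThan)
      also have "\<dots> = (\<Sum>p<n. if p = l then (if l < r then U $$ (i,l) * S $$ (l,l) else 0) else 0)"
        using that S by (intro sum.cong) (auto simp: trunc_diag_def)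
      finally show ?thesis .
    qed
    then show ?thesis using r by (simp add: sum.delta)
  qed
  have entry: "(U * trunc_diag r S * transpose_mat V) $$ (i,j)
      = (\<Sum>l<r. S $$ (l,l) * U $$ (i,l) * V $$ (j,l))" if "i < n" "j < m" for i j
  proof -
    have "(U * trunc_diag r S * transpose_mat V) $$ (i,j)
        = (\<Sum>l<m. (U * trunc_diag r S) $$ (i,l) * V $$ (j,l))"
      using that U V D by (subst index_mult_mat(1)) (auto simp: scalar_prod_def atLeast0LessThan)
    also have "\<dots> = (\<Sum>l<m. if l < r then S $$ (l,l) * U $$ (i,l) * V $$ (j,l) else 0)"
      using UD[OF that(1)] by (intro sum.cong) auto
    also have "\<dots> = (\<Sum>l<r. S $$ (l,l) * U $$ (i,l) * V $$ (j,l))"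
      using r by (intro sum.mono_neutral_cong_right) auto
    finally show ?thesis .
  qed
  show ?thesis
    unfolding represents_def
  proof (intro allI)
    fix x i
    have "coord (sing_op (\<lambda>l. S $$ (l,l)) (\<lambda>l. embed_vec (col U l)) (\<lambda>l. embed_vec (col V l)) {..<r} x) i
        = (if i < n then \<Sum>l<r. \<Sum>j<m. S $$ (l,l) * U $$ (i,l) * V $$ (j,l) * coord x j else 0)"
      using U V r
      by (auto simp: sing_op_def coord_sum coord_simps coord_embed_vec inner_embed_vec sum_distrib_left
          sum_distrib_right mult_ac intro!: sum.cong)
    also have "\<dots> = (if i < n then \<Sum>j<m. (U * trunc_diag r S * transpose_mat V) $$ (i,j) * coord x j else 0)"
      using entry by (subst sum.swap) (simp add: sum_distrib_right)
    finally show "coord (sing_op (\<lambda>l. S $$ (l,l)) (\<lambda>l. embed_vec (col U l)) (\<lambda>l. embed_vec (col V l)) {..<r} x) i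
        = (if i < dim_row (U * trunc_diag r S * transpose_mat V)
           then \<Sum>j<dim_col (U * trunc_diag r S * transpose_mat V).
             (U * trunc_diag r S * transpose_mat V) $$ (i,j) * coord x j else 0)"
      using U V by simp
  qed
qed

lemma svd_represents_full:
  assumes svd: "is_svd A U S V" and A: "A \<in> carrier_mat n m"
  shows "represents A
    (sing_op (\<lambda>l. S $$ (l,l)) (\<lambda>l. embed_vec (col U l)) (\<lambda>l. embed_vec (col V l)) {..<min n m})"
proof -
  have "trunc_diag (min n m) S = S"
    using svd A by (intro eq_matI) (auto simp: trunc_diag_def is_svd_def)
  then show ?thesis using svd_represents[OF assms order_refl] svd by (simp add: is_svd_def)
qed

lemma svd_orthonormal:
  assumes "is_svd A U S V" "A \<in> carrier_mat n m"
  shows "orthonormal_on {..<min n m} (\<lambda>l. embed_vec (col U l))"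
    "orthonormal_on {..<min n m} (\<lambda>l. embed_vec (col V l))"
  using assms orthonormal_embed_cols[of n U] orthonormal_embed_cols[of m V]
  by (auto simp: is_svd_def intro: orthonormal_on_subset)

lemma sing_pair_svd:
  assumes "is_svd A U S V" "A \<in> carrier_mat n m" "is_svd B U' S' V'" "B \<in> carrier_mat n m"
    and T: "represents (B - A) T" "\<And>x. norm (T x) \<le> e * norm x" and e: "0 \<le> e"
  shows "sing_pair (\<lambda>l. S $$ (l,l)) (\<lambda>l. embed_vec (col U l)) (\<lambda>l. embed_vec (col V l))
    (\<lambda>l. S' $$ (l,l)) (\<lambda>l. embed_vec (col U' l)) (\<lambda>l. embed_vec (col V' l)) (min n m) e"
  using svd_orthonormal[OF assms(1,2)] svd_orthonormal[OF assms(3,4)] assms e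
    represents_unique[OF T(1) represents_diff[OF assms(4,2) svd_represents_full[OF assms(3,4)]
        svd_represents_full[OF assms(1,2)]]]
  by unfold_locales (auto simp: is_svd_def)

text \<open>Two decompositions of one matrix differ by an operator of norm 0, and Weyl's inequality
  with e = 0 in both directions equates their entries. This connects the decompositions behind the
  thresholdings with the one chosen in \<open>sing_val\<close>.\<close>

lemma sing_val_eq:
  assumes svd: "is_svd A U S V" and A: "A \<in> carrier_mat n m" and j: "1 \<le> j" "j \<le> min n m"
  shows "sing_val A j = S $$ (j - 1, j - 1)"
proof -
  define X where "X = (SOME (U,S,V). is_svd A U S V)"
  obtain U0 S0 V0 where X: "X = (U0, S0, V0)" by (cases X)
  have "(\<lambda>(U,S,V). is_svd A U S V) X"
    unfolding X_def by (rule someI[of _ "(U, S, V)"]) (use svd in simp)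
  then have svd0: "is_svd A U0 S0 V0" by (simp add: X)
  have T: "represents (A - A) (\<lambda>_. 0)"
    using A by (auto simp: represents_def coord_simps)
  have "S $$ (j - 1, j - 1) \<le> S0 $$ (j - 1, j - 1) + 0"
    using j by (intro sing_pair.weyl[OF sing_pair_svd[OF svd0 A svd A T]]) auto
  moreover have "S0 $$ (j - 1, j - 1) \<le> S $$ (j - 1, j - 1) + 0"
    using j by (intro sing_pair.weyl[OF sing_pair_svd[OF svd A svd0 A T]]) auto
  ultimately show ?thesis
    using j A by (simp add: sing_val_def X_def[symmetric] X)
qed

section \<open>Transfer of the bounds to matrices\<close>

theorem theorem3p13:
  fixes A E Ar Atr Er :: "real mat" and n m r :: nat
  assumes "A \<in> carrier_mat n m" and "E \<in> carrier_mat n m"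
    and "1 \<le> r" and "r < min n m"
    and "is_rank_thresh A r Ar"
    and "is_rank_thresh (A + E) r Atr"
    and "is_rank_thresh E r Er"
  shows "spec_norm (Ar - Atr) \<le> 2 * spec_norm E + 2 * sing_val A (r+1) * gap_factor A E r \<and>
         frob_norm (Ar - Atr) \<le>
           sqrt (2 * (frob_norm Er)^2 +
                 3 * (frob_norm Er + sqrt (\<Sum>k=1..r. (sing_val A (r+k))^2) * gap_factor A E r)^2)"
proof -
  note A = assms(1) and E = assms(2) and r = assms(3,4)
  define k where "k = min n m"
  have rk: "r < k" "r \<le> min n m" "0 < k" "0 < m" using r by (auto simp: k_def)
  have AE: "A + E \<in> carrier_mat n m" using A E by simp
  obtain U S V where svd: "is_svd A U S V" and Ar: "Ar = U * trunc_diag r S * transpose_mat V"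
    using assms(5) by (auto simp: is_rank_thresh_def)
  obtain U' S' V' where svd': "is_svd (A + E) U' S' V'" and Atr: "Atr = U' * trunc_diag r S' * transpose_mat V'"
    using assms(6) by (auto simp: is_rank_thresh_def)
  obtain W D Y where svdE: "is_svd E W D Y" and Er: "Er = W * trunc_diag r D * transpose_mat Y"
    using assms(7) by (auto simp: is_rank_thresh_def)
  define s u v where "s = (\<lambda>l. S $$ (l,l))" and "u = (\<lambda>l. embed_vec (col U l))" and "v = (\<lambda>l. embed_vec (col V l))"
  define s' u' v' where "s' = (\<lambda>l. S' $$ (l,l))" and "u' = (\<lambda>l. embed_vec (col U' l))" and "v' = (\<lambda>l. embed_vec (col V' l))"
  define t w y where "t = (\<lambda>l. D $$ (l,l))" and "w = (\<lambda>l. embed_vec (col W l))" and "y = (\<lambda>l. embed_vec (col Y l))"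
  have on: "orthonormal_on {..<k} u" "orthonormal_on {..<k} v" "orthonormal_on {..<k} w" "orthonormal_on {..<k} y"
    using svd_orthonormal[OF svd A] svd_orthonormal[OF svdE E] by (simp_all add: k_def u_def v_def w_def y_def)
  have t: "0 \<le> t i" "i \<le> j \<Longrightarrow> t j \<le> t i" if "i < k" "j < k" for i j
    using svdE E that by (auto simp: is_svd_def t_def k_def)
  have repA: "represents A (sing_op s u v {..<k})"
    and repA': "represents (A + E) (sing_op s' u' v' {..<k})"
    and repE: "represents E (sing_op t w y {..<k})"
    using svd_represents_full[OF svd A] svd_represents_full[OF svd' AE] svd_represents_full[OF svdE E]
    by (simp_all add: k_def s_def u_def v_def s'_def u'_def v'_def t_def w_def y_def)
  have repr: "represents Ar (sing_op s u v {..<r})" "represents Atr (sing_op s' u' v' {..<r})"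
    "represents Er (sing_op t w y {..<r})"
    unfolding Ar Atr Er
    using svd_represents[OF svd A rk(2)] svd_represents[OF svd' AE rk(2)] svd_represents[OF svdE E rk(2)]
    by (simp_all add: s_def u_def v_def s'_def u'_def v'_def t_def w_def y_def)
  have car: "Ar \<in> carrier_mat n m" "Atr \<in> carrier_mat n m" "Er \<in> carrier_mat n m"
    unfolding Ar Atr Er
    by (rule svd_trunc_carrier[OF svd A] svd_trunc_carrier[OF svd' AE] svd_trunc_carrier[OF svdE E])+
  define X where "X x = sing_op s u v {..<r} x - sing_op s' u' v' {..<r} x" for x
  have repX: "represents (Ar - Atr) X"
    unfolding X_def by (rule represents_diff[OF car(1,2) repr(1,2)])
  have eq: "sing_op s' u' v' {..<k} x = sing_op s u v {..<k} x + sing_op t w y {..<k} x" for x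
    by (rule represents_unique[OF repA' represents_add[OF A E repA repE]])

  define e where "e = spec_norm E"
  have tE: "norm (sing_op t w y {..<k} x) \<le> t 0 * norm x" for x
  proof -
    have "norm (sing_op t w y {..<k} x) \<le> t 0 * norm (proj y {..<k} x)"
      using t rk(3) by (intro norm_sing_op_le on) auto
    also have "\<dots> \<le> t 0 * norm x"
      using t rk(3) by (intro mult_left_mono norm_proj_le on) auto
    finally show ?thesis .
  qed
  \<comment> \<open>The unit vector \<open>y 0\<close> has an image of length \<open>t 0\<close>, so
    the spectral norm is at least \<open>t 0\<close>. Together with \<open>tE\<close> this makes
    \<open>e\<close> a bound on the whole sequence space.\<close>
  have "t 0 \<le> e"
  proof -
    have Y: "Y \<in> carrier_mat m m" using svdE E by (auto simp: is_svd_def orth_mat_def)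
    have ny: "norm (y 0) = 1" using on(4) rk(3) by (simp add: orthonormal_on_def norm_eq_sqrt_inner)
    have "(t 0)\<^sup>2 = (\<Sum>i<k. if i = 0 then (t i)\<^sup>2 else 0)" using rk(3) by simp
    also have "\<dots> = (norm (sing_op t w y {..<k} (y 0)))\<^sup>2"
      unfolding norm_sing_op[OF on(3) finite_lessThan]
      using on(4) rk(3) by (intro sum.cong) (auto simp: orthonormal_on_def)
    finally have "t 0 \<le> norm (sing_op t w y {..<k} (y 0))"
      by (rule power2_le_imp_le[OF eq_refl norm_ge_zero])
    also have "\<dots> \<le> e"
      unfolding e_def y_def
      by (rule norm_le_spec_norm[OF repE tE, unfolded y_def])
        (use Y E ny rk(4) in \<open>auto simp: y_def norm_embed_vec\<close>)
    finally show ?thesis .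
  qed
  then have e0: "0 \<le> e" and Ee: "norm (sing_op t w y {..<k} x) \<le> e * norm x" for x
    using t(1)[OF rk(3,3)] order_trans[OF tE mult_right_mono[of "t 0" e "norm x"]] by auto
  have "A + E - A = E" using A E by (intro eq_matI) auto
  then have repE': "represents (A + E - A) (sing_op t w y {..<k})" using repE by simp
  interpret sing_pair s u v s' u' v' k e
    unfolding k_def s_def u_def v_def s'_def u'_def v'_def
    by (rule sing_pair_svd[OF svd A svd' AE repE' Ee e0])

  \<comment> \<open>For equal singular values the test reads 2 e < 0 and fails, so \<open>g\<close>
    is 1 as the convention demands.\<close>
  define g where "g = (if 2 * e < s (r - 1) - s r then 2 * e / (s (r - 1) - s r) else 1)"
  have sv: "sing_val A j = s (j - 1)" if "1 \<le> j" "j \<le> k" for j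
    using sing_val_eq[OF svd A that(1)] that(2) by (simp add: k_def s_def)
  have sv0: "sing_val A (Suc l) = 0" if "k \<le> l" for l
    using A that by (auto simp: sing_val_def k_def)
  have sr: "sing_val A r = s (r - 1)" "sing_val A (r + 1) = s r" using sv[of r] sv[of "r + 1"] r rk by auto
  have "s r \<le> s (r - 1)" using rk by (intro s_antimono) auto
  then have g: "gap_factor A E r = g"
    unfolding gap_factor_def sr g_def e_def[symmetric] using e0 by (auto simp: min_def divide_le_eq le_divide_eq)
  have "spec_norm (Ar - Atr) \<le> 2 * e + 2 * s r * g"
    by (rule spec_norm_le[OF repX]) (use spectral_bound[OF r(1) rk(1) g_def] car rk(4) in \<open>auto simp: X_def\<close>)
  moreover have "frob_norm (Ar - Atr) \<le>
           sqrt (2 * (frob_norm Er)^2 +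
                 3 * (frob_norm Er + sqrt (\<Sum>k=1..r. (sing_val A (r+k))^2) * g)^2)"
  proof -
    define f where "f = (\<lambda>j. embed_vec (unit_vec m j))"
    have f: "orthonormal_on {..<m} f"
      using orthonormal_embed_cols[of m "1\<^sub>m m"] unfolding orthonormal_on_def f_def by (simp add: orth_mat_def)
    \<comment> \<open>The columns of \<open>Er\<close> are the images of the standard basis; summing
      over that basis, each \<open>y l\<close> contributes its squared length 1.\<close>
    have fE: "frob_norm Er = L2_set t {..<r}"
    proof -
      have onr: "orthonormal_on {..<r} w" using on(3) rk(1) by (auto intro: orthonormal_on_subset)
      have "(\<Sum>j<m. (inner (y l) (f j))\<^sup>2) = 1" if "l < r" for l
      proof -
        have Y: "dim_row Y = m" using svdE E by (auto simp: is_svd_def orth_mat_def)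
        have "(\<Sum>j<m. (inner (y l) (f j))\<^sup>2) = (\<Sum>j<m. (col Y l $ j)\<^sup>2)"
          using Y unfolding y_def f_def inner_commute[of "embed_vec (col Y l)"]
          by (intro sum.cong) (auto simp: inner_embed_vec coord_embed_vec if_distrib[of "\<lambda>x. x * _"] cong: if_cong)
        also have "\<dots> = inner (y l) (y l)"
          unfolding y_def inner_embed_vec using Y by (simp add: coord_embed_vec power2_eq_square)
        finally show ?thesis using on(4) that rk(1) by (simp add: orthonormal_on_def)
      qed
      then have "(\<Sum>j<m. (norm (sing_op t w y {..<r} (f j)))\<^sup>2) = (\<Sum>l<r. (t l)\<^sup>2)"
        unfolding norm_sing_op[OF onr finite_lessThan]
        by (subst sum.swap) (simp flip: sum_distrib_left)
      then show ?thesis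
        using frob_norm_represents[OF repr(3)] car(3) by (simp add: L2_set_def f_def)
    qed
    \<comment> \<open>\<open>sing_val\<close> counts from 1 and \<open>s\<close> from 0. Values of
      \<open>sing_val\<close> beyond min n m are 0, which explains the upper limit
      \<open>min (r + r) k\<close> of the sum.\<close>
    have "(\<Sum>k=1..r. (sing_val A (r+k))\<^sup>2) = (\<Sum>l=r..<r + r. (sing_val A (Suc l))\<^sup>2)"
      by (rule sum.reindex_bij_witness[of _ "\<lambda>l. Suc l - r" "\<lambda>k. r + k - 1"]) auto
    also have "\<dots> = (\<Sum>l=r..<min (r + r) k. (s l)\<^sup>2)"
      using sv0 by (intro sum.mono_neutral_cong_right) (auto simp: sv)
    finally have tail: "sqrt (\<Sum>k=1..r. (sing_val A (r+k))\<^sup>2) = L2_set s {r..<min (r + r) k}"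
      by (simp add: L2_set_def)
    have "(\<Sum>j<m. (norm (X (f j)))\<^sup>2)
      \<le> 2 * (frob_norm Er)\<^sup>2 + 3 * (frob_norm Er + sqrt (\<Sum>k=1..r. (sing_val A (r+k))\<^sup>2) * g)\<^sup>2"
      unfolding fE tail X_def
      using frobenius_bound[OF r(1) rk(1) g_def on(3,4) _ _ eq f] t by simp
    then show ?thesis
      using frob_norm_represents[OF repX] car by (simp add: L2_set_def f_def)
  qed
  ultimately show ?thesis unfolding g sr e_def by blast
qed

end
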